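(* Let $x>0$, let $\sigma,\mu,\xi,\zeta,\vartheta,l,m,s\in\mathbb{C}$, $\eta,\nu,k\in\mathbb{R}$ and $q\in\mathbb{R}^+$, with $\Re(\sigma)>0$, $\Re(\xi)>0$, $\Re(\zeta)>0$, $\Re(\vartheta)>0$, $\Re(\mu)>0$, $\Re(l)>0$, $\Re(m)>0$, $\Re(s)>0$, $\eta>0$ (the parameter $m$ does not occur in the formula). Assume that $\frac{\xi}{k}$, $\frac{\nu}{\eta}$ and $\nu$ are positive real numbers and $1+\frac{\xi}{k}-q-\nu\ge 0$, and that the left-hand side below is defined and the Fox-Wright series on the right-hand side converges. Then $$L\left\{z^{l-1}\left({}^{\eta}D^{\sigma}_{0+}\,t^\mu E^{\vartheta,q}_{k,\xi,\zeta}\big((tz)^\nu\big)\right)(x)\right\}=\frac{x^{\mu-\sigma\eta}}{s^l}\,\frac{\eta^\sigma}{\Gamma\left(\frac{\vartheta}{k}\right)}\,k^{1-\frac{\zeta}{k}}\;{}_{3}\Psi_{2}\left[\begin{array}{c}\left(\frac{\vartheta}{k},q\right),\ \left(\frac{\mu}{\eta}+1,\frac{\nu}{\eta}\right),\ (l,\nu);\\ \left(\frac{\zeta}{k},\frac{\xi}{k}\right),\ \left(\frac{\mu}{\eta}-\sigma+1,\frac{\nu}{\eta}\right);\end{array}\ k^{\,q-\frac{\xi}{k}}\left(\frac{x}{s}\right)^{\nu}\right],$$ where the Laplace transform is taken with respect to the variable $z$ and evaluated at $s$.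
   Context: The $k$-gamma function is $\Gamma_k(\vartheta)=k^{\frac{\vartheta}{k}-1}\Gamma\left(\frac{\vartheta}{k}\right)$, and the $k$-Pochhammer symbol is $(\vartheta)_{nq,k}=k^{nq}\left(\frac{\vartheta}{k}\right)_{nq}$, where $(a)_{nq}=\Gamma(a+nq)/\Gamma(a)$. The generalized $k$-Mittag-Leffler function is $$E^{\vartheta,q}_{k,\xi,\zeta}(z)=\sum_{n=0}^\infty\frac{(\vartheta)_{nq,k}\,z^n}{\Gamma_k(n\xi+\zeta)\,n!},$$ for $k\in\mathbb{R}$, $\Re(\xi)>0$, $\Re(\zeta)>0$, $\Re(\vartheta)>0$, $q\in\mathbb{R}^+$. The Fox-Wright function is $${}_p\Psi_q\left[\begin{array}{c}(a_1,\xi_1),\dots,(a_p,\xi_p);\\ (b_1,\zeta_1),\dots,(b_q,\zeta_q);\end{array}\ z\right]=\sum_{n=0}^\infty\frac{\prod_{i=1}^p\Gamma(a_i+\xi_i n)}{\prod_{j=1}^q\Gamma(b_j+\zeta_j n)}\frac{z^n}{n!},$$ where $\xi_i,\zeta_j\in\mathbb{R}^+$ and $1+\sum_j\zeta_j-\sum_i\xi_i\ge0$ (here $p,q$ as subscripts of $\Psi$ are the numbers of parameter pairs). As usual $1/\Gamma$ is $0$ at the poles of $\Gamma$. For $\sigma\in\mathbb{C}$, $\Re(\sigma)>0$, $\eta>0$, $n=[\Re(\sigma)]+1$ (with $[\cdot]$ the integer part) and $x>0$, the generalized fractional derivative is $$\left({}^{\eta}D^{\sigma}_{0+}f(t)\right)(x)=\frac{\eta^{\sigma-n+1}}{\Gamma(n-\sigma)}\left(x^{1-\eta}\frac{d}{dx}\right)^n\int_0^x\frac{t^{\eta-1}f(t)}{(x^\eta-t^\eta)^{\sigma-n+1}}\,dt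 .$$ It is defined when $f$ is defined on $(0,b)$ for some $b>x$ (in particular any series defining $f$ converges there), the integral converges absolutely for all upper limits near $x$, and the indicated derivatives exist at $x$. Here, for each fixed $z>0$, it acts on $f(t)=t^\mu E^{\vartheta,q}_{k,\xi,\zeta}((tz)^\nu)$ as a function of $t$. The Laplace transform of a function $g(z)$ is $L\{g(z)\}=\int_0^\infty e^{-sz}g(z)\,dz$. Powers of $s$ and $x/s$ use the principal branch. *)

theory Defs
  imports "HOL-Analysis.Analysis"
begin

text \<open>
  Complex powers are principal (\<open>powr\<close>). Since the library sets \<open>Gamma z = 0\<close> at the poles and
  \<open>w / 0 = 0\<close>, dividing by \<open>Gamma z\<close> there gives 0, which is the convention \<open>1 / Gamma z = 0\<close>.
\<close>

definition k_Gamma :: "real \<Rightarrow> complex \<Rightarrow> complex" where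
  "k_Gamma k w = of_real k powr (w / of_real k - 1) * Gamma (w / of_real k)"

definition gen_pochhammer :: "complex \<Rightarrow> real \<Rightarrow> complex" where
  "gen_pochhammer a r = Gamma (a + of_real r) / Gamma a"

definition k_pochhammer :: "real \<Rightarrow> complex \<Rightarrow> real \<Rightarrow> complex" where
  "k_pochhammer k w r = of_real k powr of_real r * gen_pochhammer (w / of_real k) r"

definition k_Mittag_Leffler_term ::
  "real \<Rightarrow> complex \<Rightarrow> complex \<Rightarrow> complex \<Rightarrow> real \<Rightarrow> complex \<Rightarrow> nat \<Rightarrow> complex" where
  "k_Mittag_Leffler_term k \<xi> \<zeta> \<theta> q w n =
     k_pochhammer k \<theta> (of_nat n * q) * w ^ n / (k_Gamma k (of_nat n * \<xi> + \<zeta>) * fact n)"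

definition k_Mittag_Leffler ::
  "real \<Rightarrow> complex \<Rightarrow> complex \<Rightarrow> complex \<Rightarrow> real \<Rightarrow> complex \<Rightarrow> complex" where
  "k_Mittag_Leffler k \<xi> \<zeta> \<theta> q w = (\<Sum>n. k_Mittag_Leffler_term k \<xi> \<zeta> \<theta> q w n)"

definition fox_wright_term ::
  "(complex \<times> real) list \<Rightarrow> (complex \<times> real) list \<Rightarrow> complex \<Rightarrow> nat \<Rightarrow> complex" where
  "fox_wright_term as bs w n =
     (\<Prod>(a, \<alpha>)\<leftarrow>as. Gamma (a + of_real \<alpha> * of_nat n)) /
     (\<Prod>(b, \<beta>)\<leftarrow>bs. Gamma (b + of_real \<beta> * of_nat n)) * (w ^ n / fact n)"

definition fox_wright ::
  "(complex \<times> real) list \<Rightarrow> (complex \<times> real) list \<Rightarrow> complex \<Rightarrow> complex" where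
  "fox_wright as bs w = (\<Sum>n. fox_wright_term as bs w n)"

definition frac_order :: "complex \<Rightarrow> nat" where
  "frac_order \<sigma> = nat \<lfloor>Re \<sigma>\<rfloor> + 1"

definition frac_kernel ::
  "real \<Rightarrow> complex \<Rightarrow> (real \<Rightarrow> complex) \<Rightarrow> real \<Rightarrow> real \<Rightarrow> complex" where
  "frac_kernel \<eta> \<sigma> f y t =
     of_real (t powr (\<eta> - 1)) * f t /
     of_real (y powr \<eta> - t powr \<eta>) powr (\<sigma> - of_nat (frac_order \<sigma>) + 1)"

definition frac_integral ::
  "real \<Rightarrow> complex \<Rightarrow> (real \<Rightarrow> complex) \<Rightarrow> real \<Rightarrow> complex" where
  "frac_integral \<eta> \<sigma> f y = integral {0<..<y} (frac_kernel \<eta> \<sigma> f y)"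

definition weighted_deriv :: "real \<Rightarrow> (real \<Rightarrow> complex) \<Rightarrow> real \<Rightarrow> complex" where
  "weighted_deriv \<eta> g x = of_real (x powr (1 - \<eta>)) * vector_derivative g (at x)"

definition frac_deriv ::
  "real \<Rightarrow> complex \<Rightarrow> (real \<Rightarrow> complex) \<Rightarrow> real \<Rightarrow> complex" where
  "frac_deriv \<eta> \<sigma> f x =
     of_real \<eta> powr (\<sigma> - of_nat (frac_order \<sigma>) + 1) / Gamma (of_nat (frac_order \<sigma>) - \<sigma>) *
     (weighted_deriv \<eta> ^^ frac_order \<sigma>) (frac_integral \<eta> \<sigma> f) x"

text \<open>
  The set \<open>A\<close> is the domain of the partial function represented by the total function \<open>f\<close>.
  An iterated derivative at \<open>x\<close> needs all but the last differentiation in a neighbourhood of \<open>x\<close>,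
  the last one only at \<open>x\<close> itself.
\<close>

definition frac_deriv_exists ::
  "real \<Rightarrow> complex \<Rightarrow> real set \<Rightarrow> (real \<Rightarrow> complex) \<Rightarrow> real \<Rightarrow> bool" where
  "frac_deriv_exists \<eta> \<sigma> A f x \<longleftrightarrow>
     (\<exists>b>x. {0<..<b} \<subseteq> A) \<and>
     (\<forall>\<^sub>F y in nhds x. frac_kernel \<eta> \<sigma> f y absolutely_integrable_on {0<..<y}) \<and>
     (\<forall>j. Suc j < frac_order \<sigma> \<longrightarrow>
        (\<forall>\<^sub>F y in nhds x. (weighted_deriv \<eta> ^^ j) (frac_integral \<eta> \<sigma> f) differentiable at y)) \<and>
     (weighted_deriv \<eta> ^^ (frac_order \<sigma> - 1)) (frac_integral \<eta> \<sigma> f) differentiable at x"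

text \<open>
  The Henstock-Kurzweil integral over the half-line covers both absolutely convergent and
  conditionally convergent improper integrals.
\<close>

definition laplace_exists :: "(real \<Rightarrow> complex) \<Rightarrow> complex \<Rightarrow> bool" where
  "laplace_exists g s \<longleftrightarrow> (\<lambda>z. exp (- s * of_real z) * g z) integrable_on {0<..}"

definition laplace :: "(real \<Rightarrow> complex) \<Rightarrow> complex \<Rightarrow> complex" where
  "laplace g s = integral {0<..} (\<lambda>z. exp (- s * of_real z) * g z)"

end

theory Submission
  imports Defs "HOL-Complex_Analysis.Conformal_Mappings"
begin

text \<open>
  The identity itself is found by integrating and differentiating term by term. Write
  \<open>p\<^sub>j = (\<mu> + \<nu> j) / \<eta>\<close> and \<open>N = frac_order \<sigma>\<close>. The substitution \<open>u = t powr \<eta>\<close> turns the fractional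
  integral of \<open>t powr (\<mu> + \<nu> j)\<close> into a Beta integral, and \<open>N\<close> weighted derivatives multiply it by
  a falling product that absorbs the Beta function into \<open>\<eta>\<^sup>\<sigma> Gamma (p\<^sub>j + 1) / Gamma (p\<^sub>j - \<sigma> + 1)\<close>
  (\<open>frac_deriv_power_series\<close>). Hence, as a function of \<open>z\<close>, the fractional derivative is an entire
  power series in \<open>z powr \<nu>\<close>, and the Laplace transform of the monomial \<open>z powr (l - 1 + \<nu> j)\<close>
  supplies the last factor \<open>Gamma (l + \<nu> j)\<close> of the Fox-Wright coefficient. Since the existence of
  the fractional derivatives for all \<open>z > 0\<close> makes the Mittag-Leffler series converge at every
  positive argument, and hence everywhere, the manipulations up to the Laplace transform are
  absolutely convergent.

  The Laplace transform is the delicate part: at \<open>s\<close> both the integral and the Fox-Wright series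
  may converge only conditionally, so the two cannot simply be interchanged there. The proof of
  \<open>laplace_power_series\<close> goes around this in three moves.

  \<^item> For large real \<open>r\<close> the interchange is absolutely convergent. Convergence of the series at \<open>s\<close>
    bounds its coefficients, which contain \<open>Gamma (l + \<nu> j)\<close>; the absolute integrals contain
    \<open>Gamma (Re l + \<nu> j)\<close> instead, and the comparison \<open>norm_Gamma_shift_ge\<close> shows that this costs only
    a constant.

  \<^item> Partial integration writes the transform at \<open>s + t\<close> as \<open>t\<close> times the Laplace transform, at \<open>t\<close>, of
    the bounded function \<open>\<lambda>z. integral {0..z} h\<close>, where \<open>h\<close> is the integrand at \<open>s\<close>. This is holomorphic
    for \<open>Re t > 0\<close>, and the series is holomorphic for \<open>norm (s + t) > norm s\<close>. The half-planes
    \<open>Re t > 0\<close> and \<open>Re (t * cnj s) > 0\<close> meet in a convex set on which both hold and which contains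
    \<open>r - s\<close> for all large real \<open>r\<close>, so the two functions agree on it.

  \<^item> Letting \<open>t = s / (n + 1)\<close> tend to \<open>0\<close> recovers the two values at \<open>s\<close>. On this ray through \<open>s\<close> the
    power series is evaluated along a radius, so that Abel's limit theorem in its radial form
    (\<open>Abel_theorem\<close>) applies, while the quotient \<open>norm t / Re t\<close> stays constant, so that its
    counterpart for Laplace integrals (\<open>half_line_laplace_abelian\<close>) applies as well.
\<close>

section \<open>Complex Gamma and Beta integrals\<close>

lemma Gamma_nonzero_Re_pos: "Re z > 0 \<Longrightarrow> Gamma z \<noteq> 0"
  by (auto simp: Gamma_eq_zero_iff elim!: nonpos_Ints_cases)

lemma of_real_powr_add_multiple:
  assumes "t > 0"
  shows "complex_of_real t powr (\<rho> + of_real \<nu> * of_nat j) = of_real t powr \<rho> * of_real (t powr \<nu>) ^ j"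
proof -
  have "complex_of_real t powr (of_real \<nu> * of_nat j) = of_real (t powr (\<nu> * real j))"
    using powr_of_real[of t "\<nu> * real j"] assms by simp
  also have "t powr (\<nu> * real j) = (t powr \<nu>) ^ j"
    using assms by (simp add: powr_powr flip: powr_realpow)
  finally show ?thesis by (simp add: powr_add)
qed

lemma has_bochner_integral_Gamma_scaled:
  fixes a :: complex and r :: real
  assumes "Re a > 0" "r > 0"
  shows "has_bochner_integral lborel
           (\<lambda>x. indicator {0<..} x *\<^sub>R (of_real x powr (a - 1) * of_real (exp (- (r * x)))))
           (Gamma a / of_real r powr a)"
proof -
  let ?f = "\<lambda>x. indicator {0<..} x *\<^sub>R (of_real x powr (a - 1) * of_real (exp (- x)) :: complex)"
  have eq: "of_real t powr (a - 1) / of_real (exp t) = of_real t powr (a - 1) * of_real (exp (- t))" for t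
    by (simp add: exp_minus field_simps)
  have "integrable lebesgue ?f"
    using absolutely_integrable_Gamma_integral'[OF assms(1)] by (simp add: set_integrable_def eq)
  hence int: "integrable lborel ?f"
    by (subst (asm) integrable_completion) auto
  have "(\<lambda>t. of_real t powr (a - 1) * of_real (exp (- t))) integrable_on {0<..}"
       "(LINT x : {0<..} | lborel. of_real x powr (a - 1) * of_real (exp (- x))) = Gamma a"
    using set_borel_integral_eq_integral[of "{0<..}" "\<lambda>t. of_real t powr (a - 1) * of_real (exp (- t)) :: complex"]
      int Gamma_integral_complex'[OF assms(1)] by (auto simp: set_integrable_def eq has_integral_iff)
  hence 1: "has_bochner_integral lborel ?f (Gamma a)"
    using int by (simp add: has_bochner_integral_iff set_lebesgue_integral_def)
  have "has_bochner_integral lborel (\<lambda>x. ?f (0 + r * x)) (Gamma a /\<^sub>R \<bar>r\<bar>)"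
    using 1 assms by (subst (asm) lborel_has_bochner_integral_real_affine_iff[of r _ _ 0]) auto
  hence "has_bochner_integral lborel (\<lambda>x. of_real r powr (1 - a) * ?f (0 + r * x))
          (of_real r powr (1 - a) * (Gamma a /\<^sub>R \<bar>r\<bar>))"
    by (rule has_bochner_integral_mult_right)
  also have "(\<lambda>x. of_real r powr (1 - a) * ?f (0 + r * x)) =
     (\<lambda>x. indicator {0<..} x *\<^sub>R (of_real x powr (a - 1) * of_real (exp (- (r * x)))))"
  proof
    fix x :: real
    have "of_real r powr (1 - a) * of_real r powr (a - 1) = (1 :: complex)"
      using assms(2) by (simp flip: powr_add)
    thus "of_real r powr (1 - a) * ?f (0 + r * x) =
      indicator {0<..} x *\<^sub>R (of_real x powr (a - 1) * of_real (exp (- (r * x))))"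
      using assms(2) by (auto simp: indicator_def zero_less_mult_iff powr_times_real)
  qed
  also have "of_real r powr (1 - a) * (Gamma a /\<^sub>R \<bar>r\<bar>) = Gamma a / of_real r powr a"
    using assms(2) by (simp add: powr_diff scaleR_conv_of_real divide_simps)
  finally show ?thesis .
qed

text \<open>
  Fubini's theorem is applied to the convolution of the two Gamma integrands. Its value at \<open>u\<close> is
  \<open>exp (-u)\<close> times the integral over \<open>{0<..<u}\<close>, which scales like \<open>u powr (a + b - 1)\<close>; integrating
  over \<open>u\<close> gives \<open>Gamma a * Gamma b\<close> on one side and \<open>Gamma (a + b)\<close> times the integral for
  \<open>u = 1\<close> on the other.
\<close>

lemma has_bochner_integral_Beta_complex:
  fixes a b :: complex and y :: real
  assumes "Re a > 0" "Re b > 0" "y > 0"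
  shows "has_bochner_integral lborel
           (\<lambda>t. indicator {0<..<y} t *\<^sub>R (of_real t powr (a - 1) * of_real (y - t) powr (b - 1)))
           (of_real y powr (a + b - 1) * Beta a b)"
proof -
  define f where "f = (\<lambda>y t. indicator {0<..<y} t *\<^sub>R (of_real t powr (a - 1) * of_real (y - t) powr (b - 1) :: complex))"
  \<comment> \<open>Both exponents may have real part in \<open>(-1, 0)\<close>; integrability comes from the real Beta integrand, which is the norm of \<open>f 1\<close>.\<close>
  define B where "B = (LINT t|lborel. f 1 t)"
  have "integrable lborel (\<lambda>t. indicator {0..1} t *\<^sub>R (t powr (Re a - 1) * (1 - t) powr (Re b - 1)))"
    using integrable_Beta[of "Re a" "Re b"] assms by (simp add: set_integrable_def)
  hence int1: "integrable lborel (f 1)"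
    by (rule Bochner_Integration.integrable_bound)
       (auto simp: f_def indicator_def norm_mult norm_powr_real_powr intro!: AE_I2)
  have scale: "has_bochner_integral lborel (f u) (of_real u powr (a + b - 1) * B)" if "u > 0" for u
  proof -
    have "has_bochner_integral lborel (f 1) B"
      using int1 by (simp add: B_def has_bochner_integral_integrable)
    hence "has_bochner_integral lborel (\<lambda>t. f 1 (0 + (1/u) * t)) (B /\<^sub>R \<bar>1/u\<bar>)"
      using that by (subst (asm) lborel_has_bochner_integral_real_affine_iff[of "1/u" _ _ 0]) auto
    hence "has_bochner_integral lborel (\<lambda>t. of_real u powr (a + b - 2) * f 1 (0 + (1/u) * t))
            (of_real u powr (a + b - 2) * (B /\<^sub>R \<bar>1/u\<bar>))"
      by (rule has_bochner_integral_mult_right)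
    also have "(\<lambda>t. of_real u powr (a + b - 2) * f 1 (0 + (1/u) * t)) = f u"
    proof
      fix t
      show "of_real u powr (a + b - 2) * f 1 (0 + (1/u) * t) = f u t"
      proof (cases "0 < t \<and> t < u")
        case True
        have "of_real t powr (a - 1) = complex_of_real u powr (a - 1) * of_real (t / u) powr (a - 1)"
          using powr_times_real[of "of_real u" "of_real (t/u)" "a - 1"] True that by simp
        moreover have "of_real (u - t) powr (b - 1) = complex_of_real u powr (b - 1) * of_real (1 - t / u) powr (b - 1)"
          using powr_times_real[of "of_real u" "of_real (1 - t/u)" "b - 1"] True that
          by (simp add: right_diff_distrib)
        moreover have "complex_of_real u powr (a + b - 2) = of_real u powr (a - 1) * of_real u powr (b - 1)"
          by (simp flip: powr_add)
        ultimately show ?thesis using True that by (simp add: f_def)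
      qed (use that in \<open>auto simp: f_def field_simps\<close>)
    qed
    also have "of_real u powr (a + b - 2) * (B /\<^sub>R \<bar>1/u\<bar>) = of_real u powr (a + b - 1) * B"
      using that powr_add[of "complex_of_real u" "a + b - 2" 1] by (simp add: scaleR_conv_of_real)
    finally show ?thesis .
  qed
  define P where "P = (\<lambda>x. indicator {0<..} x *\<^sub>R (of_real x powr (a - 1) * of_real (exp (- (1 * x)))) :: complex)"
  define Q where "Q = (\<lambda>x. indicator {0<..} x *\<^sub>R (of_real x powr (b - 1) * of_real (exp (- (1 * x)))) :: complex)"
  have P: "has_bochner_integral lborel P (Gamma a)" and Q: "has_bochner_integral lborel Q (Gamma b)"
    using has_bochner_integral_Gamma_scaled[of a 1] has_bochner_integral_Gamma_scaled[of b 1] assms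
    by (simp_all add: P_def Q_def)
  have Qs: "has_bochner_integral lborel (\<lambda>u. Q (u - t)) (Gamma b)" for t
    using Q lborel_has_bochner_integral_real_affine_iff[of 1 Q "Gamma b" "-t"] by (simp add: add.commute)
  have "integrable (lborel \<Otimes>\<^sub>M lborel) (\<lambda>(t, u). P t * Q (u - t))"
  proof (rule lborel_pair.Fubini_integrable)
    show "(\<lambda>(t, u). P t * Q (u - t)) \<in> borel_measurable (lborel \<Otimes>\<^sub>M lborel)"
      unfolding P_def Q_def by measurable
    have "(LINT u|lborel. norm (Q (u - t))) = (LINT u|lborel. norm (Q u))" for t
      using lborel_integral_real_affine[of 1 "\<lambda>u. norm (Q u)" "-t"] by (simp add: add.commute)
    thus "integrable lborel (\<lambda>t. LINT u|lborel. norm (case (t, u) of (t, u) \<Rightarrow> P t * Q (u - t)))"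
      using P by (auto simp: norm_mult has_bochner_integral_iff)
    show "AE t in lborel. integrable lborel (\<lambda>u. case (t, u) of (t, u) \<Rightarrow> P t * Q (u - t))"
      using Qs by (auto simp: has_bochner_integral_iff)
  qed
  hence "(LINT u|lborel. LINT t|lborel. P t * Q (u - t)) = (LINT t|lborel. LINT u|lborel. P t * Q (u - t))"
    by (rule lborel_pair.Fubini_integral)
  also have "\<dots> = Gamma a * Gamma b"
    using P Qs by (simp add: has_bochner_integral_iff)
  also have "(\<lambda>u. LINT t|lborel. P t * Q (u - t)) =
      (\<lambda>u. B * (indicator {0<..} u *\<^sub>R (of_real u powr (a + b - 1) * of_real (exp (- (1 * u))))))"
  proof
    fix u :: real
    have "P t * Q (u - t) = of_real (exp (-u)) * f u t" for t
      using exp_add[of "-t" "t-u"] 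
      by (auto simp: P_def Q_def f_def indicator_def simp flip: of_real_mult)
    hence "(LINT t|lborel. P t * Q (u - t)) = of_real (exp (-u)) * (LINT t|lborel. f u t)" by simp
    thus "(LINT t|lborel. P t * Q (u - t)) =
        B * (indicator {0<..} u *\<^sub>R (of_real u powr (a + b - 1) * of_real (exp (- (1 * u)))))"
      using scale[of u] by (cases "u > 0") (simp_all add: has_bochner_integral_iff f_def)
  qed
  also have "(LINT u|lborel. B * (indicator {0<..} u *\<^sub>R (of_real u powr (a + b - 1) * of_real (exp (- (1 * u)))))) 
      = B * Gamma (a + b)"
  proof -
    have "has_bochner_integral lborel (\<lambda>u. indicator {0<..} u *\<^sub>R (of_real u powr (a + b - 1) * of_real (exp (- (1 * u)))))
            (Gamma (a + b))"
      using has_bochner_integral_Gamma_scaled[of "a + b" 1] assms by simp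
    thus ?thesis
      by (intro has_bochner_integral_integral_eq has_bochner_integral_mult_right)
  qed
  finally have "B * Gamma (a + b) = Gamma a * Gamma b" .
  moreover have "Gamma (a + b) \<noteq> 0"
    using assms by (intro Gamma_nonzero_Re_pos) auto
  ultimately have "B = Beta a b" by (simp add: Beta_def field_simps)
  with scale[OF assms(3)] show ?thesis by (simp add: f_def)
qed

section \<open>Fractional integrals of power series\<close>

text \<open>
  The substitution \<open>u = t powr \<eta>\<close> reduces this to a Beta integral over \<open>{0<..<y powr \<eta>}\<close>.
\<close>

lemma integral_fractional_power:
  fixes p b :: complex and \<eta> y :: real
  assumes "\<eta> > 0" "y > 0" "Re p > -1" "Re b > 0"
  defines "F \<equiv> \<lambda>t. of_real (t powr (\<eta> - 1)) * of_real t powr (of_real \<eta> * p) * of_real (y powr \<eta> - t powr \<eta>) powr (b - 1)"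
  shows "F absolutely_integrable_on {0<..<y}"
    and "integral {0<..<y} F = of_real y powr (of_real \<eta> * (p + b)) * Beta (p + 1) b / of_real \<eta>"
proof -
  let ?S = "{0<..<y}" and ?g = "\<lambda>t::real. t powr \<eta>" and ?h = "\<lambda>t::real. \<eta> * t powr (\<eta> - 1)"
  let ?f = "\<lambda>u::real. of_real u powr p * of_real (y powr \<eta> - u) powr (b - 1) :: complex"
  have img: "?g ` ?S = {0<..<y powr \<eta>}"
  proof (intro equalityI subsetI)
    fix u assume u: "u \<in> {0<..<y powr \<eta>}"
    have "u powr (1 / \<eta>) < (y powr \<eta>) powr (1 / \<eta>)"
      using u assms by (intro powr_less_mono2) auto
    hence "u powr (1 / \<eta>) \<in> ?S" using u assms by (simp add: powr_powr)
    moreover have "u = ?g (u powr (1 / \<eta>))" using u assms by (simp add: powr_powr)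
    ultimately show "u \<in> ?g ` ?S" by blast
  qed (use assms in \<open>auto intro!: powr_less_mono2\<close>)
  have inj: "inj_on ?g ?S"
  proof (rule inj_onI)
    fix s t assume "s \<in> ?S" "t \<in> ?S" "s powr \<eta> = t powr \<eta>"
    hence "(s powr \<eta>) powr (1 / \<eta>) = (t powr \<eta>) powr (1 / \<eta>)" by simp
    thus "s = t" using \<open>s \<in> ?S\<close> \<open>t \<in> ?S\<close> assms(1) by (simp add: powr_powr)
  qed
  have der: "(?g has_field_derivative ?h x) (at x within ?S)" if "x \<in> ?S" for x
    using that by (auto intro!: derivative_eq_intros)
  have meas: "?S \<in> sets lebesgue" by auto
  have f: "has_bochner_integral lborel (\<lambda>u. indicator {0<..<y powr \<eta>} u *\<^sub>R ?f u)
          (of_real (y powr \<eta>) powr (p + b) * Beta (p + 1) b)"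
    using has_bochner_integral_Beta_complex[of "p + 1" b "y powr \<eta>"] assms by simp
  hence "set_integrable lborel {0<..<y powr \<eta>} ?f"
    by (simp add: set_integrable_def has_bochner_integral_iff)
  hence "?f absolutely_integrable_on {0<..<y powr \<eta>}"
    and "integral {0<..<y powr \<eta>} ?f = of_real (y powr \<eta>) powr (p + b) * Beta (p + 1) b"
    using f set_borel_integral_eq_integral(2)[of "{0<..<y powr \<eta>}" ?f]
    by (auto simp: set_integrable_def integrable_completion has_bochner_integral_iff set_lebesgue_integral_def)
  hence "(\<lambda>t. \<bar>?h t\<bar> *\<^sub>R ?f (?g t)) absolutely_integrable_on ?S \<and> integral ?S (\<lambda>t. \<bar>?h t\<bar> *\<^sub>R ?f (?g t)) =
        of_real (y powr \<eta>) powr (p + b) * Beta (p + 1) b"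
    using has_absolute_integral_change_of_variables_real[OF meas der inj, of ?f] img by simp
  hence 1: "(\<lambda>t. inverse \<eta> *\<^sub>R (\<bar>?h t\<bar> *\<^sub>R ?f (?g t))) absolutely_integrable_on ?S" and
     2: "integral ?S (\<lambda>t. inverse \<eta> *\<^sub>R (\<bar>?h t\<bar> *\<^sub>R ?f (?g t))) =
        inverse \<eta> *\<^sub>R (of_real (y powr \<eta>) powr (p + b) * Beta (p + 1) b)"
    by (auto simp del: scaleR_scaleR intro!: absolutely_integrable_scaleR_left)
  have pp: "of_real (t powr \<eta>) powr w = of_real t powr (of_real \<eta> * w)" if "t > 0" for t :: real and w :: complex
    using that by (simp add: powr_def Ln_of_real mult_ac)
  have eq: "inverse \<eta> *\<^sub>R (\<bar>?h t\<bar> *\<^sub>R ?f (?g t)) = F t" if "t \<in> ?S" for t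
    using that assms(1) by (simp add: F_def pp scaleR_conv_of_real)
  show "F absolutely_integrable_on ?S"
    using 1 eq by (subst (asm) set_integrable_cong[OF refl refl eq]) auto
  have "integral ?S F = integral ?S (\<lambda>t. inverse \<eta> *\<^sub>R (\<bar>?h t\<bar> *\<^sub>R ?f (?g t)))"
    by (intro integral_cong) (use eq in auto)
  also note 2
  finally show "integral ?S F = of_real y powr (of_real \<eta> * (p + b)) * Beta (p + 1) b / of_real \<eta>"
    using assms(2) by (simp add: pp scaleR_conv_of_real field_simps)
qed

text \<open>
  A power series in a bounded quantity may be integrated term by term against any integrable
  weight, because the weight times the majorant of the series dominates everything.
\<close>

lemma sums_integral_weighted_powers:
  fixes K :: "'a \<Rightarrow> complex" and h :: "'a \<Rightarrow> real" and d :: "nat \<Rightarrow> complex"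
  assumes K: "integrable M K" and h [measurable]: "h \<in> borel_measurable M"
    and le: "\<And>t. K t \<noteq> 0 \<Longrightarrow> \<bar>h t\<bar> \<le> R"
    and d: "summable (\<lambda>j. norm (d j) * R ^ j)"
  shows "(\<lambda>j. \<integral>t. K t * (d j * of_real (h t) ^ j) \<partial>M) sums (\<integral>t. K t * (\<Sum>j. d j * of_real (h t) ^ j) \<partial>M)"
proof -
  have [measurable]: "K \<in> borel_measurable M" using K by auto
  let ?f = "\<lambda>j t. K t * (d j * of_real (h t) ^ j)"
  have bd: "norm (?f j t) \<le> norm (K t) * (norm (d j) * R ^ j)" for j t
    using le[of t] by (cases "K t = 0") (auto simp: norm_mult norm_power intro!: mult_left_mono power_mono)
  have int: "integrable M (?f j)" for j
    by (rule Bochner_Integration.integrable_bound[of _ "\<lambda>t. norm (K t) * (norm (d j) * R ^ j)"])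
       (use K bd in \<open>auto intro!: AE_I2 order.trans[OF bd]\<close>)
  have sm: "summable (\<lambda>j. norm (?f j t))" for t
    by (rule summable_comparison_test'[OF summable_mult[OF d, of "norm (K t)"], of 0]) (use bd in auto)
  have "(\<lambda>j. \<integral>t. ?f j t \<partial>M) sums (\<integral>t. (\<Sum>j. ?f j t) \<partial>M)"
  proof (rule sums_integral[OF int])
    show "AE t in M. summable (\<lambda>j. norm (?f j t))" using sm by auto
    have "(\<integral>t. norm (?f j t) \<partial>M) \<le> (\<integral>t. norm (K t) \<partial>M) * (norm (d j) * R ^ j)" for j
      using integral_mono[of M "\<lambda>t. norm (?f j t)" "\<lambda>t. norm (K t) * (norm (d j) * R ^ j)"] int K bd by simp
    thus "summable (\<lambda>j. \<integral>t. norm (?f j t) \<partial>M)"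
      by (intro summable_comparison_test'[OF summable_mult[OF d, of "\<integral>t. norm (K t) \<partial>M"], of 0])
         (auto simp: integral_nonneg_AE)
  qed
  also have "(\<lambda>t. \<Sum>j. ?f j t) = (\<lambda>t. K t * (\<Sum>j. d j * of_real (h t) ^ j))"
  proof
    fix t
    show "(\<Sum>j. ?f j t) = K t * (\<Sum>j. d j * of_real (h t) ^ j)"
    proof (cases "K t = 0")
      case False
      have "summable (\<lambda>j. d j * of_real (h t) ^ j)"
        using summable_norm_cancel[OF sm[of t]] False by (simp add: summable_cmult_iff)
      thus ?thesis by (rule suminf_mult)
    qed auto
  qed
  finally show ?thesis .
qed

lemma frac_order_minus_pos:
  assumes "Re \<sigma> > 0"
  shows "Re (of_nat (frac_order \<sigma>) - \<sigma>) > 0"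
  using assms unfolding frac_order_def by (simp; linarith)

text \<open>
  The weight is the singular kernel times \<open>t powr \<mu>\<close>, and on \<open>{0<..<y}\<close> the variable \<open>t powr \<nu>\<close> of the
  series is at most \<open>y powr \<nu>\<close>.
\<close>

lemma frac_integral_power_series:
  fixes \<sigma> \<mu> :: complex and d :: "nat \<Rightarrow> complex"
  assumes "\<eta> > 0" "\<nu> > 0" "Re \<mu> > 0" "Re \<sigma> > 0" "y > 0"
    and d: "summable (\<lambda>j. norm (d j) * (y powr \<nu>) ^ j)"
  defines "\<beta> \<equiv> of_nat (frac_order \<sigma>) - \<sigma>"
  shows "(\<lambda>j. d j * (of_real y powr (\<mu> + of_real \<nu> * of_nat j + of_real \<eta> * \<beta>) *
               Beta ((\<mu> + of_real \<nu> * of_nat j) / of_real \<eta> + 1) \<beta> / of_real \<eta>)) sums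
         frac_integral \<eta> \<sigma> (\<lambda>t. of_real t powr \<mu> * (\<Sum>j. d j * of_real (t powr \<nu>) ^ j)) y"
proof -
  let ?S = "{0<..<y}"
  define p where "p = (\<lambda>j. (\<mu> + of_real \<nu> * of_nat j) / of_real \<eta>)"
  define F where "F = (\<lambda>p t. of_real (t powr (\<eta> - 1)) * of_real t powr (of_real \<eta> * p) *
       of_real (y powr \<eta> - t powr \<eta>) powr (\<beta> - 1) :: complex)"
  define K where "K = (\<lambda>t. indicator ?S t *\<^sub>R F (p 0) t)"
  have \<beta>: "Re \<beta> > 0" using frac_order_minus_pos assms by (simp add: \<beta>_def)
  have p: "Re (p j) > -1" for j
  proof -
    have "Re (p j) \<ge> 0" using assms by (simp add: p_def)
    thus ?thesis by linarith
  qed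
  have F: "F (p j) absolutely_integrable_on ?S"
    "integral ?S (F (p j)) = of_real y powr (of_real \<eta> * (p j + \<beta>)) * Beta (p j + 1) \<beta> / of_real \<eta>" for j
    using integral_fractional_power[OF assms(1) assms(5) p[of j] \<beta>] by (simp_all add: F_def)
  have K: "integrable lebesgue K" using F(1)[of 0] by (simp add: set_integrable_def K_def)
  have Kj: "K t * (d j * of_real (t powr \<nu>) ^ j) = d j * (indicator ?S t *\<^sub>R F (p j) t)" for j t
  proof (cases "t \<in> ?S")
    case True
    have "of_real t powr (of_real \<eta> * p j) = of_real t powr (of_real \<eta> * p 0) * of_real (t powr \<nu>) ^ j"
      using True assms(1) of_real_powr_add_multiple[of t \<mu> \<nu> j] by (simp add: p_def)
    thus ?thesis using True by (simp add: K_def F_def)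
  qed (auto simp: K_def)
  have "(\<lambda>j. \<integral>t. K t * (d j * of_real (t powr \<nu>) ^ j) \<partial>lebesgue) sums
        (\<integral>t. K t * (\<Sum>j. d j * of_real (t powr \<nu>) ^ j) \<partial>lebesgue)"
  proof (rule sums_integral_weighted_powers[OF K _ _ d])
    show "(\<lambda>t. t powr \<nu>) \<in> borel_measurable lebesgue" by (intro measurable_completion) auto
    show "\<bar>t powr \<nu>\<bar> \<le> y powr \<nu>" if "K t \<noteq> 0" for t
      using that assms by (auto simp: K_def indicator_def split: if_splits intro!: powr_mono2)
  qed
  also have "(\<lambda>j. \<integral>t. K t * (d j * of_real (t powr \<nu>) ^ j) \<partial>lebesgue) =
             (\<lambda>j. d j * (of_real y powr (of_real \<eta> * (p j + \<beta>)) * Beta (p j + 1) \<beta> / of_real \<eta>))"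
  proof
    fix j
    show "(\<integral>t. K t * (d j * of_real (t powr \<nu>) ^ j) \<partial>lebesgue) = d j * (of_real y powr (of_real \<eta> * (p j + \<beta>)) * Beta (p j + 1) \<beta> / of_real \<eta>)"
      using set_lebesgue_integral_eq_integral(2)[OF F(1)[of j]] F(2)[of j]
      unfolding Kj integral_mult_right_zero set_lebesgue_integral_def by simp
  qed
  also have "(\<integral>t. K t * (\<Sum>j. d j * of_real (t powr \<nu>) ^ j) \<partial>lebesgue) =
        frac_integral \<eta> \<sigma> (\<lambda>t. of_real t powr \<mu> * (\<Sum>j. d j * of_real (t powr \<nu>) ^ j)) y" (is "_ = frac_integral _ _ ?f _")
  proof -
    have eq: "K t * (\<Sum>j. d j * of_real (t powr \<nu>) ^ j) = indicator ?S t *\<^sub>R frac_kernel \<eta> \<sigma> ?f y t" for t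
    proof (cases "t \<in> ?S")
      case True
      have "\<sigma> - of_nat (frac_order \<sigma>) + 1 = - (\<beta> - 1)" by (simp add: \<beta>_def)
      hence "z / w powr (\<sigma> - of_nat (frac_order \<sigma>) + 1) = z * w powr (\<beta> - 1)" for z w :: complex
        by (simp only: powr_minus_divide) simp
      thus ?thesis using True assms(1) unfolding frac_kernel_def
        by (simp add: K_def F_def p_def)
    qed (auto simp: K_def)
    have "integrable lebesgue (\<lambda>t. K t * (\<Sum>j. d j * of_real (t powr \<nu>) ^ j))"
    proof (rule Bochner_Integration.integrable_bound)
      show "integrable lebesgue (\<lambda>t. norm (K t) * (\<Sum>j. norm (d j) * (y powr \<nu>) ^ j))" using K by simp
      have "(\<lambda>t. \<Sum>j. d j * of_real (t powr \<nu>) ^ j) \<in> borel_measurable lborel" by measurable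
      thus "(\<lambda>t. K t * (\<Sum>j. d j * of_real (t powr \<nu>) ^ j)) \<in> borel_measurable lebesgue"
        by (intro borel_measurable_times[OF borel_measurable_integrable[OF K] measurable_completion]) auto
      show "AE t in lebesgue. norm (K t * (\<Sum>j. d j * of_real (t powr \<nu>) ^ j)) \<le>
            norm (norm (K t) * (\<Sum>j. norm (d j) * (y powr \<nu>) ^ j))"
      proof (rule AE_I2)
        fix t
        have "norm (\<Sum>j. d j * of_real (t powr \<nu>) ^ j) \<le> (\<Sum>j. norm (d j) * (y powr \<nu>) ^ j)" if "t \<in> ?S"
        proof (rule norm_suminf_le[OF _ d])
          fix j
          have "t powr \<nu> \<le> y powr \<nu>" using that assms by (intro powr_mono2) auto
          thus "norm (d j * of_real (t powr \<nu>) ^ j) \<le> norm (d j) * (y powr \<nu>) ^ j"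
            by (auto simp: norm_mult norm_power intro!: mult_left_mono power_mono)
        qed
        thus "norm (K t * (\<Sum>j. d j * of_real (t powr \<nu>) ^ j)) \<le>
            norm (norm (K t) * (\<Sum>j. norm (d j) * (y powr \<nu>) ^ j))"
          by (cases "t \<in> ?S") (auto simp: K_def norm_mult abs_mult intro!: mult_left_mono)
      qed
    qed
    hence "frac_kernel \<eta> \<sigma> ?f y absolutely_integrable_on ?S" by (simp add: set_integrable_def eq)
    from set_lebesgue_integral_eq_integral(2)[OF this]
    show ?thesis unfolding frac_integral_def eq by (simp add: set_lebesgue_integral_def)
  qed
  finally have "(\<lambda>j. d j * (of_real y powr (of_real \<eta> * (p j + \<beta>)) * Beta (p j + 1) \<beta> / of_real \<eta>)) sums
        frac_integral \<eta> \<sigma> (\<lambda>t. of_real t powr \<mu> * (\<Sum>j. d j * of_real (t powr \<nu>) ^ j)) y" .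
  moreover have "of_real \<eta> * (p j + \<beta>) = \<mu> + of_real \<nu> * of_nat j + of_real \<eta> * \<beta>" for j
    unfolding p_def using assms(1) by (simp add: field_simps)
  ultimately show ?thesis by (simp only: p_def)
qed

section \<open>Fractional derivatives of power series\<close>

text \<open>
  The class of series \<open>\<Sum>j. e j * y powr (\<rho> + \<nu> j)\<close> is closed under the weighted derivative, which
  shifts \<open>\<rho>\<close> and multiplies \<open>e j\<close> by a linear function of \<open>j\<close>; this makes the iterated
  derivatives accessible to induction.
\<close>

definition power_sum :: "complex \<Rightarrow> real \<Rightarrow> (nat \<Rightarrow> complex) \<Rightarrow> real \<Rightarrow> complex" where
  "power_sum \<rho> \<nu> e y = (\<Sum>j. e j * of_real y powr (\<rho> + of_real \<nu> * of_nat j))"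

lemma entire_linear_factor:
  fixes e :: "nat \<Rightarrow> complex"
  assumes "\<And>w. summable (\<lambda>j. e j * w ^ j)"
  shows "summable (\<lambda>j. (e j * (a + b * of_nat j)) * w ^ j)"
proof -
  have 1: "summable (\<lambda>j. of_nat j * e j * w ^ (j - Suc 0))"
    using sums_summable[OF diffs_equiv[of e w]] termdiff_converges_all[of e w] assms by simp
  have "summable (\<lambda>j. a * (e j * w ^ j) + (b * w) * (of_nat j * e j * w ^ (j - Suc 0)))"
    by (intro summable_add summable_mult assms 1)
  also have "(\<lambda>j. a * (e j * w ^ j) + (b * w) * (of_nat j * e j * w ^ (j - Suc 0))) = 
     (\<lambda>j. (e j * (a + b * of_nat j)) * w ^ j)"
  proof
    fix j show "a * (e j * w ^ j) + (b * w) * (of_nat j * e j * w ^ (j - Suc 0)) = (e j * (a + b * of_nat j)) * w ^ j"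
      by (cases j) (simp_all add: algebra_simps)
  qed
  finally show ?thesis .
qed

lemma power_sum_eq:
  fixes e :: "nat \<Rightarrow> complex"
  assumes "\<And>w. summable (\<lambda>j. e j * w ^ j)" "y > 0"
  shows "power_sum \<rho> \<nu> e y = of_real y powr \<rho> * (\<Sum>j. e j * of_real (y powr \<nu>) ^ j)"
proof -
  have "(\<lambda>j. e j * of_real y powr (\<rho> + of_real \<nu> * of_nat j)) = (\<lambda>j. of_real y powr \<rho> * (e j * of_real (y powr \<nu>) ^ j))"
    by (simp only: of_real_powr_add_multiple[OF assms(2)] mult.left_commute)
  thus ?thesis unfolding power_sum_def by (simp only: suminf_mult[OF assms(1)])
qed

text \<open>
  The sum is \<open>y powr \<rho> * E (y powr \<nu>)\<close> with \<open>E\<close> entire, so termwise differentiation in \<open>y\<close>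
  comes down to that of the power series \<open>E\<close>, by the product and chain rules.
\<close>

lemma power_sum_has_vector_derivative:
  fixes e :: "nat \<Rightarrow> complex"
  assumes e: "\<And>w. summable (\<lambda>j. e j * w ^ j)" and y: "y > 0"
  shows "(power_sum \<rho> \<nu> e has_vector_derivative
           power_sum (\<rho> - 1) \<nu> (\<lambda>j. e j * (\<rho> + of_real \<nu> * of_nat j)) y) (at y)"
proof -
  define E where "E = (\<lambda>w. \<Sum>j. e j * w ^ j)"
  define E' where "E' = (\<lambda>w. \<Sum>j. diffs e j * w ^ j)"
  let ?w = "complex_of_real (y powr \<nu>)"
  have E: "(E has_field_derivative E' w) (at w)" for w
    unfolding E_def E'_def by (rule termdiffs_strong_converges_everywhere[OF e])
  have wE: "(\<lambda>j. of_nat j * e j * w ^ j) sums (w * E' w)" for w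
  proof -
    have "(\<lambda>j. of_nat j * e j * w ^ (j - Suc 0)) sums E' w"
      unfolding E'_def by (rule diffs_equiv, rule termdiff_converges_all[OF e])
    hence "(\<lambda>j. w * (of_nat j * e j * w ^ (j - Suc 0))) sums (w * E' w)" by (rule sums_mult)
    also have "(\<lambda>j. w * (of_nat j * e j * w ^ (j - Suc 0))) = (\<lambda>j. of_nat j * e j * w ^ j)"
    proof
      fix j show "w * (of_nat j * e j * w ^ (j - Suc 0)) = of_nat j * e j * w ^ j" by (cases j) auto
    qed
    finally show ?thesis .
  qed
  have "((\<lambda>u. complex_of_real u powr \<rho> * E (complex_of_real u powr \<nu>)) has_vector_derivative
         \<rho> * of_real y powr (\<rho> - 1) * E ?w + of_real y powr \<rho> * (E' ?w * (of_real \<nu> * of_real y powr (of_real \<nu> - 1)))) (at y)"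
  proof -
    have "((\<lambda>u. u powr \<rho> * E (u powr of_real \<nu>)) has_field_derivative
         \<rho> * of_real y powr (\<rho> - 1) * E ?w + of_real y powr \<rho> * (E' ?w * (of_real \<nu> * of_real y powr (of_real \<nu> - 1))))
         (at (complex_of_real y))"
      using y powr_of_real[of y \<nu>]
      by (auto intro!: derivative_eq_intros DERIV_chain2[OF E])
    thus ?thesis by (rule has_vector_derivative_real_field)
  qed
  moreover have "of_real y powr \<rho> * (E' ?w * (of_real \<nu> * of_real y powr (of_real \<nu> - 1))) =
      of_real y powr (\<rho> - 1) * (of_real \<nu> * (?w * E' ?w))"
  proof -
    have "of_real y powr \<rho> = of_real y powr (\<rho> - 1) * complex_of_real y"
      using y powr_add[of "complex_of_real y" "\<rho> - 1" 1] by simp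
    moreover have "?w = of_real y * of_real y powr (of_real \<nu> - 1)"
      using y powr_add[of "complex_of_real y" 1 "\<nu> - 1"] powr_of_real[of y \<nu>] by simp
    ultimately show ?thesis by (simp add: mult_ac)
  qed
  moreover have "\<rho> * of_real y powr (\<rho> - 1) * E ?w + of_real y powr (\<rho> - 1) * (of_real \<nu> * (?w * E' ?w)) = 
     power_sum (\<rho> - 1) \<nu> (\<lambda>j. e j * (\<rho> + of_real \<nu> * of_nat j)) y"
  proof -
    have "(\<lambda>j. \<rho> * (e j * ?w ^ j) + of_real \<nu> * (of_nat j * e j * ?w ^ j)) sums (\<rho> * E ?w + of_real \<nu> * (?w * E' ?w))"
      unfolding E_def by (intro sums_add sums_mult wE summable_sums e)
    also have "(\<lambda>j. \<rho> * (e j * ?w ^ j) + of_real \<nu> * (of_nat j * e j * ?w ^ j)) =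
        (\<lambda>j. e j * (\<rho> + of_real \<nu> * of_nat j) * ?w ^ j)" by (simp add: algebra_simps)
    finally have S: "(\<Sum>j. e j * (\<rho> + of_real \<nu> * of_nat j) * ?w ^ j) = \<rho> * E ?w + of_real \<nu> * (?w * E' ?w)"
      by (rule sums_unique[symmetric])
    show ?thesis
      unfolding power_sum_eq[OF entire_linear_factor[OF e] y] S by (simp add: algebra_simps)
  qed
  ultimately have "((\<lambda>u. complex_of_real u powr \<rho> * E (complex_of_real u powr \<nu>)) has_vector_derivative
       power_sum (\<rho> - 1) \<nu> (\<lambda>j. e j * (\<rho> + of_real \<nu> * of_nat j)) y) (at y)" by simp
  thus ?thesis
  proof (rule has_vector_derivative_transform_within_open)
    show "open {0::real<..}" "y \<in> {0<..}" using y by auto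
    show "complex_of_real u powr \<rho> * E (complex_of_real u powr \<nu>) = power_sum \<rho> \<nu> e u" if "u \<in> {0<..}" for u
      using power_sum_eq[OF e, of u] that by (simp add: E_def powr_of_real)
  qed
qed

text \<open>
  The function is prescribed on the positive half-line only, since a fractional integral and its
  iterated derivatives agree with such a sum only there.
\<close>

lemma weighted_deriv_power_sum:
  fixes e :: "nat \<Rightarrow> complex"
  assumes e: "\<And>w. summable (\<lambda>j. e j * w ^ j)" and y: "y > 0"
    and F: "\<And>u. u > 0 \<Longrightarrow> F u = power_sum \<rho> \<nu> e u"
  shows "weighted_deriv \<eta> F y = power_sum (\<rho> - of_real \<eta>) \<nu> (\<lambda>j. e j * (\<rho> + of_real \<nu> * of_nat j)) y"
proof -
  have "(F has_vector_derivative power_sum (\<rho> - 1) \<nu> (\<lambda>j. e j * (\<rho> + of_real \<nu> * of_nat j)) y) (at y)"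
    by (rule has_vector_derivative_transform_within_open[OF power_sum_has_vector_derivative[OF e y], of "{0<..}"])
       (use y F in auto)
  hence "weighted_deriv \<eta> F y = of_real (y powr (1 - \<eta>)) * power_sum (\<rho> - 1) \<nu> (\<lambda>j. e j * (\<rho> + of_real \<nu> * of_nat j)) y"
    unfolding weighted_deriv_def by (simp add: vector_derivative_at)
  moreover have "of_real (y powr (1 - \<eta>)) * complex_of_real y powr (\<rho> - 1) = of_real y powr (\<rho> - of_real \<eta>)"
    using y by (simp add: powr_of_real[of y "1 - \<eta>", symmetric] flip: powr_add)
  ultimately show ?thesis
    by (simp only: power_sum_eq[OF entire_linear_factor[OF e] y] mult.assoc[symmetric])
qed

lemma iterated_weighted_deriv_power_sum:
  fixes e :: "nat \<Rightarrow> complex" and \<eta> :: real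
  assumes e: "\<And>w. summable (\<lambda>j. e j * w ^ j)"
    and F: "\<And>u. u > 0 \<Longrightarrow> F u = power_sum \<rho> \<nu> e u"
  defines "e' \<equiv> \<lambda>m j. e j * (\<Prod>i<m. \<rho> + of_real \<nu> * of_nat j - of_nat i * of_real \<eta>)"
  shows "(\<forall>w. summable (\<lambda>j. e' m j * w ^ j)) \<and>
         (\<forall>y>0. (weighted_deriv \<eta> ^^ m) F y = power_sum (\<rho> - of_nat m * of_real \<eta>) \<nu> (e' m) y)"
proof (induction m)
  case 0
  show ?case using e F by (simp add: e'_def)
next
  case (Suc m)
  have IH: "summable (\<lambda>j. e' m j * w ^ j)" 
    "y > 0 \<Longrightarrow> (weighted_deriv \<eta> ^^ m) F y = power_sum (\<rho> - of_nat m * of_real \<eta>) \<nu> (e' m) y" for w y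
    using Suc by auto
  have eq: "e' m j * ((\<rho> - of_nat m * of_real \<eta>) + of_real \<nu> * of_nat j) = e' (Suc m) j" for j
    by (simp add: e'_def fun_eq_iff mult.assoc add_diff_eq diff_add_eq)
  have eq': "\<rho> - of_nat m * of_real \<eta> - of_real \<eta> = \<rho> - of_nat (Suc m) * of_real \<eta>"
    by (simp add: algebra_simps)
  have "summable (\<lambda>j. e' (Suc m) j * w ^ j)" for w
    using entire_linear_factor[OF IH(1)] unfolding eq[symmetric] .
  moreover have "(weighted_deriv \<eta> ^^ Suc m) F y = power_sum (\<rho> - of_nat (Suc m) * of_real \<eta>) \<nu> (e' (Suc m)) y"
    if "y > 0" for y
    using weighted_deriv_power_sum[OF IH(1) that IH(2), where \<eta> = \<eta>] unfolding eq eq' by simp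
  ultimately show ?case by blast
qed

text \<open>
  The argument \<open>p + b + 1 - n\<close> may be a pole of \<open>Gamma\<close>. The recurrence for the reciprocal Gamma
  function holds there too and makes both sides vanish.
\<close>

lemma Beta_times_falling_product:
  fixes p b :: complex
  assumes "Re p > -1" "Re b > 0"
  shows "Beta (p + 1) b * (\<Prod>i<n. p + b - of_nat i) = Gamma b * (Gamma (p + 1) / Gamma (p + b + 1 - of_nat n))"
proof -
  have "rGamma (p + b + 1 - of_nat n) = pochhammer (p + b + 1 - of_nat n) n * rGamma (p + b + 1)"
    using pochhammer_rGamma[of "p + b + 1 - of_nat n" n] by simp
  also have "pochhammer (p + b + 1 - of_nat n) n = (\<Prod>i<n. p + b - of_nat i)"
    unfolding pochhammer_prod 
    by (subst prod.nat_diff_reindex[symmetric]) (auto intro!: prod.cong simp: of_nat_diff lessThan_atLeast0)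
  finally have "(\<Prod>i<n. p + b - of_nat i) * inverse (Gamma (p + b + 1)) = inverse (Gamma (p + b + 1 - of_nat n))"
    by (simp add: rGamma_inverse_Gamma)
  moreover have "Beta (p + 1) b * (\<Prod>i<n. p + b - of_nat i) =
      Gamma b * (Gamma (p + 1) * ((\<Prod>i<n. p + b - of_nat i) * inverse (Gamma (p + b + 1))))"
    by (simp add: Beta_def divide_inverse add_ac mult_ac)
  ultimately show ?thesis by (simp add: divide_inverse)
qed

text \<open>
  Each term of the fractional integral is a Beta value times a power of \<open>x\<close>, and the \<open>N\<close> weighted
  derivatives contribute \<open>\<eta> ^ N\<close> times the falling product of \<open>p j + (N - \<sigma>)\<close>. The remaining factor
  \<open>Gamma (N - \<sigma>)\<close> cancels against the normalisation of the fractional derivative.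
\<close>

lemma frac_deriv_power_series:
  fixes \<sigma> \<mu> :: complex and d :: "nat \<Rightarrow> complex"
  assumes "\<eta> > 0" "\<nu> > 0" "Re \<mu> > 0" "Re \<sigma> > 0" "x > 0"
    and d: "\<And>w. summable (\<lambda>j. d j * w ^ j)"
  defines "p \<equiv> \<lambda>j. (\<mu> + of_real \<nu> * of_nat j) / of_real \<eta>"
  defines "c \<equiv> \<lambda>j. d j * (Gamma (p j + 1) / Gamma (p j - \<sigma> + 1))"
  shows "summable (\<lambda>j. c j * w ^ j)"
    and "frac_deriv \<eta> \<sigma> (\<lambda>t. of_real t powr \<mu> * (\<Sum>j. d j * of_real (t powr \<nu>) ^ j)) x =
         of_real \<eta> powr \<sigma> * of_real x powr (\<mu> - \<sigma> * of_real \<eta>) * (\<Sum>j. c j * of_real (x powr \<nu>) ^ j)"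
proof -
  define N where "N = frac_order \<sigma>"
  define \<beta> where "\<beta> = of_nat N - \<sigma>"
  define f where "f = (\<lambda>t. of_real t powr \<mu> * (\<Sum>j. d j * of_real (t powr \<nu>) ^ j))"
  define e where "e = (\<lambda>j. d j * Beta (p j + 1) \<beta> / of_real \<eta>)"
  define \<rho> where "\<rho> = \<mu> + of_real \<eta> * \<beta>"
  have \<beta>: "Re \<beta> > 0" using frac_order_minus_pos assms by (simp add: \<beta>_def N_def)
  hence \<beta>0: "Gamma \<beta> \<noteq> 0" by (rule Gamma_nonzero_Re_pos)
  have p: "Re (p j) > -1" for j
  proof -
    have "Re (p j) \<ge> 0" using assms by (simp add: p_def)
    thus ?thesis by linarith
  qed
  have nd: "summable (\<lambda>j. norm (d j) * u ^ j)" if "u > 0" for u :: real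
    using powser_insidea[OF d, of "of_real u" "of_real (u + 1)"] that by (simp add: norm_mult norm_power)
  have I: "(\<lambda>j. e j * of_real y powr (\<rho> + of_real \<nu> * of_nat j)) sums frac_integral \<eta> \<sigma> f y" if y: "y > 0" for y
    using frac_integral_power_series[OF assms(1-4) y nd[of "y powr \<nu>"]] y
    by (simp add: f_def e_def \<rho>_def p_def \<beta>_def N_def algebra_simps)
  \<comment> \<open>The termwise integrals are summable for every \<open>y\<close>; choosing \<open>y\<close> with \<open>y powr \<nu> > norm w\<close> gives an infinite radius of convergence without estimating the Beta factors.\<close>
  have e: "summable (\<lambda>j. e j * w ^ j)" for w
  proof -
    define y where "y = (norm w + 1) powr (1 / \<nu>)"
    have "norm w + 1 > 0" by (simp add: add_nonneg_pos)
    hence y: "y > 0" "y powr \<nu> = norm w + 1" using assms by (auto simp: y_def powr_powr)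
    have "summable (\<lambda>j. of_real y powr \<rho> * (e j * of_real (y powr \<nu>) ^ j))"
      using sums_summable[OF I[OF y(1)]] by (simp only: of_real_powr_add_multiple[OF y(1)] mult.left_commute)
    hence "summable (\<lambda>j. e j * of_real (y powr \<nu>) ^ j)" using y(1) by (simp add: summable_cmult_iff)
    thus ?thesis by (rule powser_inside) (use y in auto)
  qed
  have "frac_integral \<eta> \<sigma> f y = power_sum \<rho> \<nu> e y" if "y > 0" for y
    using I[OF that] by (simp add: power_sum_def sums_iff)
  note D = iterated_weighted_deriv_power_sum[OF e this, where m = N and \<eta> = \<eta>]
  have e': "e j * (\<Prod>i<N. \<rho> + of_real \<nu> * of_nat j - of_nat i * of_real \<eta>) = 
        (of_real \<eta> ^ N / of_real \<eta> * Gamma \<beta>) * c j" (is "?l j = ?r j") for j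
  proof -
    have "(\<Prod>i<N. \<rho> + of_real \<nu> * of_nat j - of_nat i * of_real \<eta>) = (\<Prod>i<N. of_real \<eta> * (p j + \<beta> - of_nat i))"
      using assms(1) by (intro prod.cong) (auto simp: \<rho>_def p_def field_simps)
    also have "\<dots> = of_real \<eta> ^ N * (\<Prod>i<N. p j + \<beta> - of_nat i)"
      by (simp add: prod.distrib)
    finally have "?l j = of_real \<eta> ^ N / of_real \<eta> * d j * (Beta (p j + 1) \<beta> * (\<Prod>i<N. p j + \<beta> - of_nat i))"
      by (simp add: e_def)
    also have "p j + \<beta> + 1 - of_nat N = p j - \<sigma> + 1" by (simp add: \<beta>_def)
    note Beta_times_falling_product[OF p \<beta>, of j N, unfolded this]
    finally show ?thesis by (simp add: c_def)
  qed
  have eta: "of_real \<eta> ^ N / of_real \<eta> * Gamma \<beta> \<noteq> 0" using assms(1) \<beta>0 by simp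
  have D1: "summable (\<lambda>j. ((of_real \<eta> ^ N / of_real \<eta> * Gamma \<beta>) * c j) * w ^ j)" for w
    using D unfolding e' by blast
  hence c: "summable (\<lambda>j. c j * w ^ j)" for w
    using eta by (simp add: mult.assoc summable_cmult_iff)
  thus "summable (\<lambda>j. c j * w ^ j)" for w .
  have lN: "\<rho> - of_nat N * of_real \<eta> = \<mu> - \<sigma> * of_real \<eta>" by (simp add: \<rho>_def \<beta>_def algebra_simps)
  have "(weighted_deriv \<eta> ^^ N) (frac_integral \<eta> \<sigma> f) x = 
      power_sum (\<mu> - \<sigma> * of_real \<eta>) \<nu> (\<lambda>j. (of_real \<eta> ^ N / of_real \<eta> * Gamma \<beta>) * c j) x"
    using D assms(5) unfolding e' lN by blast
  also have "\<dots> = of_real x powr (\<mu> - \<sigma> * of_real \<eta>) * ((of_real \<eta> ^ N / of_real \<eta> * Gamma \<beta>) * (\<Sum>j. c j * of_real (x powr \<nu>) ^ j))"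
    unfolding power_sum_eq[OF D1 assms(5)] by (simp only: mult.assoc suminf_mult[OF summable_mult[OF c]] suminf_mult[OF c])
  finally have W: "(weighted_deriv \<eta> ^^ N) (frac_integral \<eta> \<sigma> f) x = \<dots>" .
  have "of_real \<eta> powr (\<sigma> - of_nat N + 1) * (of_real \<eta> ^ N / of_real \<eta>) = complex_of_real \<eta> powr \<sigma>"
    using assms(1) by (simp add: powr_add powr_diff powr_nat')
  hence const: "of_real \<eta> powr (\<sigma> - of_nat N + 1) / Gamma \<beta> * (of_real \<eta> ^ N / of_real \<eta> * Gamma \<beta>) = complex_of_real \<eta> powr \<sigma>"
    using \<beta>0 by simp
  show "frac_deriv \<eta> \<sigma> (\<lambda>t. of_real t powr \<mu> * (\<Sum>j. d j * of_real (t powr \<nu>) ^ j)) x =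
         of_real \<eta> powr \<sigma> * of_real x powr (\<mu> - \<sigma> * of_real \<eta>) * (\<Sum>j. c j * of_real (x powr \<nu>) ^ j)"
    unfolding frac_deriv_def f_def[symmetric] N_def[symmetric] W \<beta>_def[symmetric] const[symmetric]
    by (simp only: mult_ac)
qed

section \<open>A Gamma quotient bound and Abel's limit theorem\<close>

text \<open>
  After division by \<open>Gamma b\<close> this says that the norm of a complex Beta integral is at most the
  integral of the norm. It bounds \<open>Gamma (Re l + b)\<close> by \<open>norm (Gamma (l + b))\<close> up to a factor that does
  not depend on \<open>b\<close>, and replaces an asymptotic estimate of Gamma on vertical lines.
\<close>

lemma norm_Gamma_shift_ge:
  fixes l :: complex and b :: real
  assumes "Re l > 0" "b \<ge> 0"
  shows "norm (Gamma l) * Gamma (Re l + b) \<le> Gamma (Re l) * norm (Gamma (l + of_real b))"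
proof (cases "b = 0")
  case False
  with assms have "b > 0" by simp
  note assms = assms(1) this
  let ?f = "\<lambda>t. indicator {0<..<1} t *\<^sub>R (of_real t powr (l - 1) * of_real (1 - t) powr (of_real b - 1) :: complex)"
  let ?g = "\<lambda>t. indicator {0<..<1} t *\<^sub>R (of_real t powr (of_real (Re l) - 1) * of_real (1 - t) powr (of_real b - 1) :: complex)"
  have f: "has_bochner_integral lborel ?f (Beta l (of_real b))"
    using has_bochner_integral_Beta_complex[of l "of_real b" 1] assms by simp
  have g: "has_bochner_integral lborel ?g (Beta (of_real (Re l)) (of_real b))"
    using has_bochner_integral_Beta_complex[of "of_real (Re l)" "of_real b" 1] assms by simp
  have eq: "?g t = of_real (norm (?f t))" for t
    using powr_of_real[of t "Re l - 1"] powr_of_real[of "1 - t" "b - 1"]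
    by (auto simp: indicator_def norm_mult norm_powr_real_powr)
  have "norm (Beta l (of_real b)) \<le> (LINT t|lborel. norm (?f t))"
    using integral_norm_bound[of lborel ?f] f by (simp add: has_bochner_integral_iff)
  also have "(LINT t|lborel. norm (?f t)) = Beta (Re l) b"
  proof -
    have "(LINT t|lborel. complex_of_real (norm (?f t))) = Beta (of_real (Re l)) (of_real b)"
      using g unfolding eq by (rule has_bochner_integral_integral_eq)
    thus ?thesis by (simp only: integral_complex_of_real Beta_complex_of_real of_real_eq_iff)
  qed
  finally have "norm (Gamma l) * \<bar>Gamma b\<bar> / norm (Gamma (l + of_real b)) \<le> Gamma (Re l) * Gamma b / Gamma (Re l + b)"
    by (simp add: Beta_def norm_mult norm_divide Gamma_complex_of_real)
  moreover have "Gamma b > 0" "Gamma (Re l + b) > 0" "norm (Gamma (l + of_real b)) > 0"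
    using assms Gamma_nonzero_Re_pos[of "l + of_real b"] by (auto intro!: Gamma_real_pos)
  ultimately show ?thesis by (simp add: field_simps)
qed simp

text \<open>
  With the tails \<open>R n = (\<Sum>i. b (i + n))\<close>, summation by parts gives
  \<open>(\<Sum>n. b n * x ^ n) = R 0 - (1 - x) * (\<Sum>n. R (Suc n) * x ^ n)\<close>. The tails tend to \<open>0\<close>, so the last
  series is \<open>o (1 / (1 - x))\<close>.
\<close>

lemma Abel_theorem:
  fixes b :: "nat \<Rightarrow> complex"
  assumes b: "summable b"
  shows "((\<lambda>x. \<Sum>n. b n * of_real x ^ n) \<longlongrightarrow> suminf b) (at_left 1)"
proof -
  define R where "R = (\<lambda>n. \<Sum>i. b (i + n))"
  have bR: "b n = R n - R (Suc n)" for n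
    using suminf_split_head[of "\<lambda>i. b (i + n)"] b by (simp add: R_def summable_ignore_initial_segment)
  have R0: "R \<longlonglongrightarrow> 0" unfolding R_def by (rule suminf_exist_split2[OF b])
  then obtain M where M: "\<And>n. norm (R n) \<le> M"
    using convergent_imp_Bseq[of R] by (auto simp: convergent_def Bseq_def)
  have sumR: "summable (\<lambda>n. R (n + k) * of_real x ^ n)" if "0 < x" "x < 1" for x :: real and k
    by (rule summable_comparison_test'[OF summable_mult[OF summable_geometric[of x], of M], of 0])
       (use that M in \<open>auto simp: norm_mult norm_power intro!: mult_right_mono\<close>)
  have eq: "(\<Sum>n. b n * of_real x ^ n) = suminf b - of_real (1 - x) * (\<Sum>n. R (Suc n) * of_real x ^ n)"
    if x: "0 < x" "x < 1" for x :: real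
  proof -
    have "(\<Sum>n. b n * of_real x ^ n) = (\<Sum>n. R n * of_real x ^ n - R (Suc n) * of_real x ^ n)"
      by (simp add: bR left_diff_distrib)
    also have "\<dots> = (\<Sum>n. R n * of_real x ^ n) - (\<Sum>n. R (Suc n) * of_real x ^ n)"
      using sumR[OF x, of 0] sumR[OF x, of 1] by (intro suminf_diff[symmetric]) auto
    also have "(\<Sum>n. R n * of_real x ^ n) = R 0 + (\<Sum>n. R (Suc n) * of_real x ^ n) * of_real x"
      using powser_split_head(1)[of R "of_real x"] sumR[OF x, of 0] by simp
    finally show ?thesis by (simp add: R_def algebra_simps)
  qed
  have "((\<lambda>x. of_real (1 - x) * (\<Sum>n. R (Suc n) * of_real x ^ n)) \<longlongrightarrow> 0) (at_left 1)"
  proof (rule tendstoI)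
    fix e :: real assume e: "e > 0"
    from tendstoD[OF R0, of "e / 2"] obtain N where N: "\<And>n. n \<ge> N \<Longrightarrow> norm (R n) < e / 2"
      using e by (auto simp: eventually_sequentially)
    have "((\<lambda>x. (1 - x) * (\<Sum>n<N. norm (R (Suc n)))) \<longlongrightarrow> (1 - 1) * (\<Sum>n<N. norm (R (Suc n)))) (at_left 1)"
      by (intro tendsto_intros)
    hence "eventually (\<lambda>x. (1 - x) * (\<Sum>n<N. norm (R (Suc n))) < e / 2) (at_left 1)"
      by (rule order_tendstoD) (use e in auto)
    moreover have "eventually (\<lambda>x::real. x \<in> {0<..<1}) (at_left 1)"
      by (rule eventually_at_leftI[of 0]) auto
    ultimately show "eventually (\<lambda>x. dist (of_real (1 - x) * (\<Sum>n. R (Suc n) * of_real x ^ n)) 0 < e) (at_left 1)"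
    proof eventually_elim
      case (elim x)
      hence x: "0 < x" "x < 1" by auto
      let ?t = "\<lambda>n. if n < N then norm (R (Suc n)) else 0"
      have g: "(\<lambda>n. e / 2 * x ^ n) sums (e / 2 * (1 / (1 - x)))"
        using x by (intro sums_mult geometric_sums) auto
      have t: "?t sums (\<Sum>n<N. norm (R (Suc n)))"
        using sums_If_finite[of "\<lambda>n. n < N" "\<lambda>n. norm (R (Suc n))"] by (simp add: lessThan_def)
      have "norm (\<Sum>n. R (Suc n) * of_real x ^ n) \<le> (\<Sum>n. ?t n + e / 2 * x ^ n)"
      proof (rule norm_suminf_le)
        show "norm (R (Suc n) * of_real x ^ n) \<le> ?t n + e / 2 * x ^ n" for n
        proof (cases "n < N")
          case True
          have "norm (R (Suc n)) * x ^ n \<le> norm (R (Suc n))"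
            using x by (intro mult_left_le power_le_one) auto
          thus ?thesis using True x e by (simp add: norm_mult norm_power add_increasing2)
        next
          case False
          thus ?thesis using N[of "Suc n"] x by (auto simp: norm_mult norm_power intro!: mult_right_mono less_imp_le)
        qed
        show "summable (\<lambda>n. ?t n + e / 2 * x ^ n)" by (intro summable_add sums_summable[OF t] sums_summable[OF g])
      qed
      also have "\<dots> = (\<Sum>n<N. norm (R (Suc n))) + e / 2 * (1 / (1 - x))"
        using sums_unique[OF sums_add[OF t g]] by simp
      finally have "(1 - x) * norm (\<Sum>n. R (Suc n) * of_real x ^ n) \<le>
            (1 - x) * ((\<Sum>n<N. norm (R (Suc n))) + e / 2 * (1 / (1 - x)))"
        using x by (intro mult_left_mono) auto
      also have "\<dots> = (1 - x) * (\<Sum>n<N. norm (R (Suc n))) + e / 2"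
      proof -
        have cancel: "d * (e / 2 * (1 / d)) = e / 2" if "d > 0" for d :: real
          using that by simp
        have "1 - x > 0" using x by simp
        from cancel[OF this] have "(1 - x) * (e / 2 * (1 / (1 - x))) = e / 2" .
        thus ?thesis by (simp only: distrib_left)
      qed
      also have "\<dots> < e" using elim by simp
      finally have "(1 - x) * norm (\<Sum>n. R (Suc n) * of_real x ^ n) < e" .
      moreover have "norm (complex_of_real (1 - x)) = 1 - x" using x by (simp only: norm_of_real)
      ultimately show ?case by (simp only: dist_norm diff_0_right norm_mult)
    qed
  qed
  hence "((\<lambda>x. suminf b - of_real (1 - x) * (\<Sum>n. R (Suc n) * of_real x ^ n)) \<longlongrightarrow> suminf b - 0) (at_left 1)"
    by (intro tendsto_intros)
  hence lim: "((\<lambda>x. suminf b - of_real (1 - x) * (\<Sum>n. R (Suc n) * of_real x ^ n)) \<longlongrightarrow> suminf b) (at_left 1)"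
    by simp
  have "eventually (\<lambda>x::real. x \<in> {0<..<1}) (at_left 1)"
    by (rule eventually_at_leftI[of 0]) auto
  hence "eventually (\<lambda>x. suminf b - of_real (1 - x) * (\<Sum>n. R (Suc n) * of_real x ^ n) = (\<Sum>n. b n * of_real x ^ n)) (at_left 1)"
    by eventually_elim (use eq in auto)
  from Lim_transform_eventually[OF lim this] show ?thesis .
qed

section \<open>Laplace transforms of bounded functions\<close>

definition half_line_laplace :: "(real \<Rightarrow> complex) \<Rightarrow> complex \<Rightarrow> complex" where
  "half_line_laplace \<phi> t = (LINT z|lborel. indicator {0<..} z *\<^sub>R (exp (- t * of_real z) * \<phi> z))"

text \<open>
  The constant is included because the bound \<open>C * exp (- \<delta> * z)\<close> serves as the dominating function
  throughout.
\<close>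

lemma integrable_exp_half_line:
  fixes \<delta> :: real
  assumes "\<delta> > 0"
  shows "integrable lborel (\<lambda>z. indicator {0<..} z * (C * exp (- \<delta> * z)))"
proof -
  have "integrable lborel (\<lambda>z. C * norm (indicator {0<..} z *\<^sub>R (of_real z powr (1 - 1) * of_real (exp (- (\<delta> * z))) :: complex)))"
    using has_bochner_integral_Gamma_scaled[of 1 \<delta>] assms
    by (intro integrable_mult_right integrable_norm) (auto simp: has_bochner_integral_iff)
  also have "(\<lambda>z. C * norm (indicator {0<..} z *\<^sub>R (of_real z powr (1 - 1) * of_real (exp (- (\<delta> * z))) :: complex))) =
      (\<lambda>z. indicator {0<..} z * (C * exp (- \<delta> * z)))"
    by (auto simp: indicator_def)
  finally show ?thesis .
qed

lemma integrable_half_line_laplace: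
  fixes \<phi> :: "real \<Rightarrow> complex"
  assumes \<phi>: "continuous_on {0<..} \<phi>" and M: "\<And>z. z > 0 \<Longrightarrow> norm (\<phi> z) \<le> M" and t: "Re t > 0"
  shows "integrable lborel (\<lambda>z. indicator {0<..} z *\<^sub>R (exp (- t * of_real z) * \<phi> z))"
proof (rule Bochner_Integration.integrable_bound[OF integrable_exp_half_line[OF t, of M]])
  show "(\<lambda>z. indicator {0<..} z *\<^sub>R (exp (- t * of_real z) * \<phi> z)) \<in> borel_measurable lborel"
    using \<phi> by (simp, intro borel_measurable_continuous_on_indicator continuous_intros) auto
  show "AE z in lborel. norm (indicator {0<..} z *\<^sub>R (exp (- t * of_real z) * \<phi> z)) \<le>
           norm (indicator {0<..} z * (M * exp (- Re t * z)))"
    by (rule AE_I2) (use M order.trans[OF norm_ge_zero M] in 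
        \<open>auto simp: indicator_def norm_mult mult.commute intro!: mult_right_mono\<close>)
qed

lemma tendsto_integral_half_line:
  fixes f :: "real \<Rightarrow> complex"
  assumes f: "integrable lborel (\<lambda>z. indicator {0<..} z *\<^sub>R f z)"
  shows "((\<lambda>Z. integral {0..Z} f) \<longlongrightarrow> (LINT z|lborel. indicator {0<..} z *\<^sub>R f z)) at_top"
    and "Z \<ge> 0 \<Longrightarrow> f integrable_on {0..Z}"
proof -
  have "((\<lambda>Z. LINT z:{..Z}|lborel. indicator {0<..} z *\<^sub>R f z) \<longlongrightarrow> (LINT z|lborel. indicator {0<..} z *\<^sub>R f z)) at_top"
    unfolding set_lebesgue_integral_def by (rule tendsto_integral_at_top) (use f in auto)
  moreover have *: "f integrable_on {0..Z} \<and> (LINT z:{..Z}|lborel. indicator {0<..} z *\<^sub>R f z) = integral {0..Z} f" if "Z \<ge> 0" for Z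
  proof -
    have eq: "(\<lambda>z. indicator {..Z} z *\<^sub>R (indicator {0<..} z *\<^sub>R f z)) = (\<lambda>z. indicator {0<..Z} z *\<^sub>R f z)"
      by (auto simp: indicator_def)
    have "integrable lborel (\<lambda>z. indicator {..Z} z *\<^sub>R (indicator {0<..} z *\<^sub>R f z))"
      by (rule integrable_mult_indicator[OF _ f]) auto
    hence "set_integrable lborel {0<..Z} f" unfolding set_integrable_def eq .
    note I = set_borel_integral_eq_integral[OF this]
    have "negligible ({0..Z} - {0<..Z} \<union> ({0<..Z} - {0..Z}))"
      by (rule negligible_subset[of "{0}"]) auto
    hence neg: "negligible {x \<in> {0..Z} - {0<..Z}. f x \<noteq> 0}" "negligible {x \<in> {0<..Z} - {0..Z}. f x \<noteq> 0}"
      by (auto elim!: negligible_subset)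
    have "(f has_integral integral {0<..Z} f) {0..Z}"
      using has_integral_spike_set_eq[OF neg] I(1) by (simp only: integrable_integral)
    moreover have "(LINT z:{..Z}|lborel. indicator {0<..} z *\<^sub>R f z) = integral {0<..Z} f"
      using I(2) unfolding set_lebesgue_integral_def eq .
    ultimately show ?thesis by (auto simp: has_integral_iff)
  qed
  moreover have "eventually (\<lambda>Z::real. Z \<ge> 0) at_top" by (rule eventually_ge_at_top)
  ultimately show "((\<lambda>Z. integral {0..Z} f) \<longlongrightarrow> (LINT z|lborel. indicator {0<..} z *\<^sub>R f z)) at_top"
    by (elim Lim_transform_eventually) (rule eventually_mono, assumption, blast)
  show "Z \<ge> 0 \<Longrightarrow> f integrable_on {0..Z}" using * by blast
qed

text \<open>
  The truncated integrals over \<open>{0..n}\<close> are entire, and on a small disc around a point of the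
  half-plane they converge uniformly, since there \<open>Re t\<close> is bounded below by some \<open>\<delta> > 0\<close> and the
  truncation error is at most the integral of \<open>M * exp (- \<delta> * z)\<close> beyond \<open>n\<close>.
\<close>

lemma holomorphic_half_line_laplace:
  fixes \<phi> :: "real \<Rightarrow> complex"
  assumes \<phi>: "continuous_on {0..} \<phi>" and M: "\<And>z. z > 0 \<Longrightarrow> norm (\<phi> z) \<le> M"
  shows "half_line_laplace \<phi> holomorphic_on {t. Re t > 0}"
proof (rule holomorphic_uniform_sequence)
  have \<phi>': "continuous_on {0<..} \<phi>" by (rule continuous_on_subset[OF \<phi>]) auto
  have int: "integrable lborel (\<lambda>z. indicator {0<..} z *\<^sub>R (exp (- t * of_real z) * \<phi> z))" if "Re t > 0" for t
    by (rule integrable_half_line_laplace[OF \<phi>' M that])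
  show "open {t. Re t > 0}" by (rule open_halfspace_Re_gt)
  show "(\<lambda>t. integral (cbox 0 (real n)) (\<lambda>z. exp (- t * of_real z) * \<phi> z)) holomorphic_on {t. Re t > 0}" for n
  proof (rule leibniz_rule_holomorphic)
    show "((\<lambda>t. exp (- t * of_real z) * \<phi> z) has_field_derivative (- of_real z * exp (- t * of_real z) * \<phi> z)) (at t within {t. Re t > 0})"
      for t z by (auto intro!: derivative_eq_intros)
    have c: "continuous_on {0..real n} \<phi>" by (rule continuous_on_subset[OF \<phi>]) auto
    show "(\<lambda>z. exp (- t * of_real z) * \<phi> z) integrable_on cbox 0 (real n)" for t
      by (intro integrable_continuous continuous_intros) (use c in auto)
    have "continuous_on ({t. Re t > 0} \<times> cbox 0 (real n)) (\<lambda>x. \<phi> (snd x))"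
      by (rule continuous_on_compose2[OF c]) (auto intro!: continuous_intros)
    thus "continuous_on ({t. Re t > 0} \<times> cbox 0 (real n)) (\<lambda>(t, z). - of_real z * exp (- t * of_real z) * \<phi> z)"
      by (auto simp: case_prod_unfold intro!: continuous_intros)
    show "convex {t. Re t > 0}" by (rule convex_halfspace_Re_gt)
  qed
  fix t0 :: complex assume "t0 \<in> {t. Re t > 0}"
  hence t0: "Re t0 > 0" by simp
  define \<delta> where "\<delta> = Re t0 / 2"
  have \<delta>: "\<delta> > 0" using t0 by (simp add: \<delta>_def)
  have ge: "Re t \<ge> \<delta>" if "t \<in> cball t0 \<delta>" for t
    using that abs_Re_le_cmod[of "t0 - t"] by (auto simp: \<delta>_def dist_norm)
  define T where "T = (\<lambda>n::nat. LINT z|lborel. indicator {real n<..} z * (indicator {0<..} z * (M * exp (- \<delta> * z))))"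
  have T: "T \<longlonglongrightarrow> (LINT z|(lborel::real measure). 0)"
    unfolding T_def
  proof (rule integral_dominated_convergence)
    show "integrable lborel (\<lambda>z. indicator {0<..} z * (\<bar>M\<bar> * exp (- \<delta> * z)))"
      by (rule integrable_exp_half_line[OF \<delta>])
    show "AE z in lborel. (\<lambda>n. indicator {real n<..} z * (indicator {0<..} z * (M * exp (- \<delta> * z)))) \<longlonglongrightarrow> 0"
    proof (rule AE_I2)
      fix z :: real
      obtain N :: nat where N: "z \<le> real N" using real_arch_simple by blast
      have "eventually (\<lambda>n. indicator {real n<..} z * (indicator {0<..} z * (M * exp (- \<delta> * z))) = 0) sequentially"
        by (rule eventually_sequentiallyI[of N]) (use N in \<open>auto simp: indicator_def\<close>)
      thus "(\<lambda>n. indicator {real n<..} z * (indicator {0<..} z * (M * exp (- \<delta> * z)))) \<longlonglongrightarrow> 0"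
        by (rule tendsto_eventually)
    qed
  qed (auto simp: indicator_def abs_mult intro!: AE_I2)
  have bd: "norm (integral (cbox 0 (real n)) (\<lambda>z. exp (- t * of_real z) * \<phi> z) - half_line_laplace \<phi> t) \<le> T n"
    if t: "t \<in> cball t0 \<delta>" for t n
  proof -
    have Ret: "Re t > 0" using ge[OF t] \<delta> by simp
    let ?f = "\<lambda>z. exp (- t * of_real z) * \<phi> z"
    have "set_integrable lborel {0<..} ?f"
      using int[OF Ret] by (simp add: set_integrable_def)
    hence si: "set_integrable lborel {0<..real n} ?f" by (rule set_integrable_subset) auto
    have "integral (cbox 0 (real n)) ?f = integral {0<..real n} ?f"
      by (rule integral_spike_set) (auto intro: negligible_subset[of "{0}"])
    also have "\<dots> = (LINT z|lborel. indicator {0<..real n} z *\<^sub>R ?f z)"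
      using set_borel_integral_eq_integral(2)[OF si] by (simp add: set_lebesgue_integral_def)
    finally have "half_line_laplace \<phi> t - integral (cbox 0 (real n)) ?f =
        (LINT z|lborel. indicator {0<..} z *\<^sub>R ?f z - indicator {0<..real n} z *\<^sub>R ?f z)"
      using int[OF Ret] si unfolding half_line_laplace_def set_integrable_def by simp
    also have "norm \<dots> \<le> T n"
      unfolding T_def
    proof (rule order.trans[OF integral_norm_bound Bochner_Integration.integral_mono], rule integrable_norm)
      show "integrable lborel (\<lambda>z. indicator {0<..} z *\<^sub>R ?f z - indicator {0<..real n} z *\<^sub>R ?f z)"
        using int[OF Ret] si unfolding set_integrable_def by simp
      show "integrable lborel (\<lambda>z. indicator {real n<..} z * (indicator {0<..} z * (M * exp (- \<delta> * z))))"
        using integrable_mult_indicator[OF _ integrable_exp_half_line[OF \<delta>, of M], of "{real n<..}"] by simp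
      fix z :: real
      show "norm (indicator {0<..} z *\<^sub>R ?f z - indicator {0<..real n} z *\<^sub>R ?f z) \<le>
          indicator {real n<..} z * (indicator {0<..} z * (M * exp (- \<delta> * z)))"
      proof (cases "z > real n")
        case True
        hence z: "z > 0" using of_nat_0_le_iff[of n, where ?'a = real] by linarith
        have "norm (exp (- t * of_real z)) \<le> exp (- \<delta> * z)"
          using mult_right_mono[OF ge[OF t], of z] z by simp
        hence "norm (exp (- t * of_real z)) * norm (\<phi> z) \<le> exp (- \<delta> * z) * M"
          by (rule mult_mono[OF _ M[OF z]]) auto
        moreover have "indicator {0<..} z *\<^sub>R ?f z - indicator {0<..real n} z *\<^sub>R ?f z = ?f z"
          using True z by (auto simp: indicator_def)
        moreover have "indicator {real n<..} z * (indicator {0<..} z * (M * exp (- \<delta> * z))) = exp (- \<delta> * z) * M"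
          using True z by (auto simp: indicator_def)
        ultimately show ?thesis by (simp only: norm_mult)
      next
        case False
        hence "indicator {0<..} z = (indicator {0<..real n} z :: real)" by (auto simp: indicator_def)
        thus ?thesis using False by simp
      qed
    qed
    finally show ?thesis by (simp add: norm_minus_commute)
  qed
  have "uniform_limit (cball t0 \<delta>) (\<lambda>n t. integral (cbox 0 (real n)) (\<lambda>z. exp (- t * of_real z) * \<phi> z))
          (half_line_laplace \<phi>) sequentially"
  proof (rule uniform_limitI)
    fix e :: real assume "e > 0"
    from T have "eventually (\<lambda>n. T n < e) sequentially"
      by (rule order_tendstoD) (use \<open>e > 0\<close> in auto)
    thus "eventually (\<lambda>n. \<forall>t\<in>cball t0 \<delta>. dist (integral (cbox 0 (real n)) (\<lambda>z. exp (- t * of_real z) * \<phi> z)) (half_line_laplace \<phi> t) < e) sequentially"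
      by eventually_elim (use bd in \<open>fastforce simp: dist_norm intro: order.strict_trans1\<close>)
  qed
  moreover have "cball t0 \<delta> \<subseteq> {t. Re t > 0}" using ge \<delta> by fastforce
  ultimately show "\<exists>d>0. cball t0 d \<subseteq> {t. Re t > 0} \<and> uniform_limit (cball t0 d) (\<lambda>n t. integral (cbox 0 (real n)) (\<lambda>z. exp (- t * of_real z) * \<phi> z))
          (half_line_laplace \<phi>) sequentially"
    using \<delta> by blast
qed

lemma tendsto_exp_decay:
  assumes "Re s > 0"
  shows "((\<lambda>Z. exp (- s * of_real Z)) \<longlongrightarrow> (0 :: complex)) at_top"
proof (rule tendsto_norm_zero_cancel)
  have "((\<lambda>Z. exp (- (Re s * Z))) \<longlongrightarrow> 0) at_top"
    using assms by (intro filterlim_compose[OF exp_at_bot] filterlim_compose[OF filterlim_uminus_at_bot_at_top]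
        filterlim_tendsto_pos_mult_at_top[OF tendsto_const _ filterlim_ident])
  thus "((\<lambda>Z. norm (exp (- s * of_real Z))) \<longlongrightarrow> 0) at_top" by simp
qed

text \<open>
  The substitution \<open>z = (n + 1) v\<close> turns \<open>\<tau> n * half_line_laplace \<phi> (\<tau> n)\<close> into \<open>s\<close> times the integral of
  \<open>exp (- s * v) * \<phi> ((n + 1) * v)\<close>. By dominated convergence this tends to \<open>s * (L / s)\<close>. The points
  \<open>\<tau> n\<close> approach \<open>0\<close> along the ray through \<open>s\<close>, so that one dominating function serves for all \<open>n\<close>.
\<close>

lemma half_line_laplace_abelian:
  fixes \<phi> :: "real \<Rightarrow> complex"
  assumes \<phi>: "continuous_on {0..} \<phi>" and M: "\<And>z. z > 0 \<Longrightarrow> norm (\<phi> z) \<le> M"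
    and L: "(\<phi> \<longlongrightarrow> L) at_top" and s: "Re s > 0"
  defines "\<tau> \<equiv> \<lambda>n::nat. s / of_nat (Suc n)"
  shows "(\<lambda>n. \<tau> n * half_line_laplace \<phi> (\<tau> n)) \<longlonglongrightarrow> L"
proof -
  have \<phi>': "continuous_on {0<..} \<phi>" by (rule continuous_on_subset[OF \<phi>]) auto
  have [measurable]: "(\<lambda>z. indicator {0<..} z *\<^sub>R \<phi> z) \<in> borel_measurable borel"
    using \<phi>' by (intro borel_measurable_continuous_on_indicator) auto
  have scale: "\<tau> n * half_line_laplace \<phi> (\<tau> n) =
      s * (LINT v|lborel. indicator {0<..} v *\<^sub>R (exp (- s * of_real v) * \<phi> (real (Suc n) * v)))" for n
  proof -
    have "half_line_laplace \<phi> (\<tau> n) = \<bar>real (Suc n)\<bar> *\<^sub>R (LINT v|lborel. indicator {0<..} (0 + real (Suc n) * v) *\<^sub>R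
             (exp (- \<tau> n * of_real (0 + real (Suc n) * v)) * \<phi> (0 + real (Suc n) * v)))"
      unfolding half_line_laplace_def by (rule lborel_integral_real_affine) auto
    also have "(\<lambda>v. indicator {0<..} (0 + real (Suc n) * v) *\<^sub>R
             (exp (- \<tau> n * of_real (0 + real (Suc n) * v)) * \<phi> (0 + real (Suc n) * v))) =
             (\<lambda>v. indicator {0<..} v *\<^sub>R (exp (- s * of_real v) * \<phi> (real (Suc n) * v)))"
    proof
      fix v :: real
      have "- \<tau> n * of_real (0 + real (Suc n) * v) = - s * of_real v"
        by (simp add: \<tau>_def del: of_nat_Suc)
      moreover have "indicator {0<..} (0 + real (Suc n) * v) = (indicator {0<..} v :: real)"
        by (simp add: indicator_def zero_less_mult_iff del: of_nat_Suc)
      ultimately show "indicator {0<..} (0 + real (Suc n) * v) *\<^sub>R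
             (exp (- \<tau> n * of_real (0 + real (Suc n) * v)) * \<phi> (0 + real (Suc n) * v)) =
          indicator {0<..} v *\<^sub>R (exp (- s * of_real v) * \<phi> (real (Suc n) * v))"
        by (simp only: add_0)
    qed
    finally show ?thesis
      by (simp add: \<tau>_def scaleR_conv_of_real del: of_nat_Suc)
  qed
  have lim: "(\<lambda>n. LINT v|lborel. indicator {0<..} v *\<^sub>R (exp (- s * of_real v) * \<phi> (real (Suc n) * v))) \<longlonglongrightarrow>
        (LINT v|lborel. indicator {0<..} v *\<^sub>R (exp (- s * of_real v) * L))"
  proof (rule integral_dominated_convergence)
    show "integrable lborel (\<lambda>v. indicator {0<..} v * (M * exp (- Re s * v)))"
      by (rule integrable_exp_half_line[OF s])
    show "AE v in lborel. (\<lambda>n. indicator {0<..} v *\<^sub>R (exp (- s * of_real v) * \<phi> (real (Suc n) * v))) \<longlonglongrightarrow>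
          indicator {0<..} v *\<^sub>R (exp (- s * of_real v) * L)"
    proof (rule AE_I2)
      fix v :: real
      show "(\<lambda>n. indicator {0<..} v *\<^sub>R (exp (- s * of_real v) * \<phi> (real (Suc n) * v))) \<longlonglongrightarrow>
          indicator {0<..} v *\<^sub>R (exp (- s * of_real v) * L)"
      proof (cases "v > 0")
        case True
        have "filterlim (\<lambda>n. v * real (Suc n)) at_top sequentially"
          by (rule filterlim_tendsto_pos_mult_at_top[OF tendsto_const True])
             (rule filterlim_compose[OF filterlim_real_sequentially filterlim_Suc])
        hence "filterlim (\<lambda>n. real (Suc n) * v) at_top sequentially" by (simp only: mult.commute)
        from filterlim_compose[OF L this]
        show ?thesis by (rule tendsto_scaleR[OF tendsto_const tendsto_mult[OF tendsto_const]])
      qed auto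
    qed
    show "AE v in lborel. norm (indicator {0<..} v *\<^sub>R (exp (- s * of_real v) * \<phi> (real (Suc n) * v))) \<le>
           indicator {0<..} v * (M * exp (- Re s * v))" for n
      by (rule AE_I2) (use M in \<open>auto simp: indicator_def norm_mult mult.commute simp del: of_nat_Suc intro!: mult_right_mono\<close>)
    have "continuous_on {0<..} (\<lambda>v. \<phi> (real (Suc n) * v))" for n
      by (rule continuous_on_compose2[OF \<phi>']) (auto intro!: continuous_intros)
    thus "(\<lambda>v. indicator {0<..} v *\<^sub>R (exp (- s * of_real v) * \<phi> (real (Suc n) * v))) \<in> borel_measurable lborel" for n
      by (simp del: of_nat_Suc, intro borel_measurable_continuous_on_indicator continuous_intros) auto
  qed auto
  have "(LINT v|lborel. indicator {0<..} v *\<^sub>R (exp (- s * of_real v) * L)) = L / s"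
  proof (rule tendsto_unique[OF _ tendsto_integral_half_line(1)])
    show "integrable lborel (\<lambda>v. indicator {0<..} v *\<^sub>R (exp (- s * of_real v) * L))"
      by (rule integrable_half_line_laplace[of "\<lambda>_. L" "norm L"]) (use s in auto)
    have int: "integral {0..Z} (\<lambda>v. exp (- s * of_real v) * L) = (1 - exp (- s * of_real Z)) * L / s" if "Z \<ge> 0" for Z
    proof -
      have "((\<lambda>v. exp (- s * of_real v) * L) has_integral
          (- exp (- s * of_real Z) * L / s - (- exp (- s * of_real 0) * L / s))) {0..Z}"
      proof (rule fundamental_theorem_of_calculus[OF that])
        fix v
        have "((\<lambda>v. - exp (- s * v) * L / s) has_field_derivative (exp (- s * of_real v) * L)) (at (of_real v))"
          using s by (auto intro!: derivative_eq_intros)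
        thus "((\<lambda>v. - exp (- s * of_real v) * L / s) has_vector_derivative exp (- s * of_real v) * L) (at v within {0..Z})"
          by (rule has_vector_derivative_at_within[OF has_vector_derivative_real_field])
      qed
      hence "integral {0..Z} (\<lambda>v. exp (- s * of_real v) * L) =
          - exp (- s * of_real Z) * L / s - (- exp (- s * of_real 0) * L / s)"
        by (rule integral_unique)
      also have "\<dots> = (1 - exp (- s * of_real Z)) * L / s"
        by (simp add: left_diff_distrib diff_divide_distrib)
      finally show ?thesis .
    qed
    have e: "((\<lambda>Z. exp (- s * of_real Z)) \<longlongrightarrow> 0) at_top"
      by (rule tendsto_exp_decay[OF s])
    have "((\<lambda>Z. (1 - exp (- s * of_real Z)) * L / s) \<longlongrightarrow> (1 - 0) * L / s) at_top"
      using s by (intro tendsto_intros e) auto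
    hence "((\<lambda>Z. (1 - exp (- s * of_real Z)) * L / s) \<longlongrightarrow> L / s) at_top"
      by (simp only: diff_zero mult_1)
    moreover have "eventually (\<lambda>Z. (1 - exp (- s * of_real Z)) * L / s = integral {0..Z} (\<lambda>v. exp (- s * of_real v) * L)) at_top"
      using eventually_ge_at_top[of 0] by eventually_elim (rule int[symmetric])
    ultimately show "((\<lambda>Z. integral {0..Z} (\<lambda>v. exp (- s * of_real v) * L)) \<longlongrightarrow> L / s) at_top"
      by (rule Lim_transform_eventually)
  qed auto
  moreover have "s * (L / s) = L" using s by auto
  ultimately show ?thesis
    unfolding scale using tendsto_mult_left[OF lim, of s] by (simp only:)
qed

text \<open>
  The integral may converge only conditionally, so boundedness cannot come from a bound on the
  integral of the norm; it comes from continuity together with the limit at infinity.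
\<close>

lemma indefinite_half_line_integral:
  fixes h :: "real \<Rightarrow> complex"
  assumes h: "h integrable_on {0<..}"
  defines "\<phi> \<equiv> \<lambda>z. integral {0..z} h"
  shows "continuous_on {0..} \<phi>" "(\<phi> \<longlongrightarrow> integral {0<..} h) at_top"
    and "\<exists>M. \<forall>z>0. norm (\<phi> z) \<le> M"
    and "\<And>z. z > 0 \<Longrightarrow> isCont h z \<Longrightarrow> (\<phi> has_vector_derivative h z) (at z)"
proof -
  have neg: "negligible {x \<in> {0..} - {0<..}. h x \<noteq> 0}" "negligible {x \<in> {0<..} - {0..}. h x \<noteq> 0}"
    by (rule negligible_subset[of "{0}"]; force)+
  have hi: "(h has_integral integral {0<..} h) {0..}"
    using has_integral_spike_set_eq[OF neg] h by (simp only: integrable_integral)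
  have int: "h integrable_on {0..Z}" for Z
    using integrable_on_subinterval[of h "{0..}" 0 Z] hi by (auto simp: has_integral_iff)
  have cont: "continuous_on {0..Z} \<phi>" for Z
    unfolding \<phi>_def by (rule indefinite_integral_continuous_1[OF int])
  have isc: "isCont \<phi> z" if "z > 0" for z
    using continuous_on_interior[OF cont[of "z + 1"]] that by auto
  show cont0: "continuous_on {0..} \<phi>"
    unfolding continuous_on_eq_continuous_within
  proof
    fix z :: real assume "z \<in> {0..}"
    hence "continuous (at z within {0..z+1}) \<phi>" using cont[of "z + 1"] by (auto simp: continuous_on_eq_continuous_within)
    thus "continuous (at z within {0..}) \<phi>"
    proof (cases "z = 0")
      case True
      thus ?thesis using \<open>continuous (at z within {0..z+1}) \<phi>\<close>
        by (simp add: continuous_within at_within_Icc_at_right at_within_Ici_at_right)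
    next
      case False
      thus ?thesis using isc[of z] \<open>z \<in> {0..}\<close>
        by (simp add: continuous_at_imp_continuous_at_within)
    qed
  qed
  show lim: "(\<phi> \<longlongrightarrow> integral {0<..} h) at_top"
  proof (rule tendstoI)
    fix e :: real assume "e > 0"
    with hi obtain B where B: "B > 0" "\<And>a b. ball 0 B \<subseteq> cbox a b \<Longrightarrow>
        norm (integral (cbox a b) (\<lambda>x. if x \<in> {0..} then h x else 0) - integral {0<..} h) < e"
      unfolding has_integral_alt' by blast
    have "dist (\<phi> Z) (integral {0<..} h) < e" if "Z \<ge> B" for Z
    proof -
      have "ball 0 B \<subseteq> cbox (-Z) Z" using that by (auto simp: dist_real_def)
      from B(2)[OF this] have "norm (integral {-Z..Z} (\<lambda>x. if x \<in> {0..} then h x else 0) - integral {0<..} h) < e" by simp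
      also have "integral {-Z..Z} (\<lambda>x. if x \<in> {0..} then h x else 0) = integral ({-Z..Z} \<inter> {0..}) h"
        by (simp only: integral_restrict_Int Int_commute)
      also have "{-Z..Z} \<inter> {0..} = {0..Z}" using that B(1) by auto
      finally show ?thesis by (simp add: \<phi>_def dist_norm)
    qed
    thus "eventually (\<lambda>Z. dist (\<phi> Z) (integral {0<..} h) < e) at_top"
      by (rule eventually_at_top_linorderI)
  qed
  show "\<exists>M. \<forall>z>0. norm (\<phi> z) \<le> M"
  proof -
    from tendstoD[OF lim, of 1] obtain Z where Z: "\<And>z. z \<ge> Z \<Longrightarrow> dist (\<phi> z) (integral {0<..} h) < 1"
      by (auto simp: eventually_at_top_linorder)
    have "bounded (\<phi> ` {0..Z})"
      by (intro compact_imp_bounded compact_continuous_image cont) auto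
    then obtain M where M: "\<And>z. z \<in> {0..Z} \<Longrightarrow> norm (\<phi> z) \<le> M"
      unfolding bounded_iff by blast
    have "norm (\<phi> z) \<le> max M (norm (integral {0<..} h) + 1)" if "z > 0" for z
    proof (cases "z \<le> Z")
      case False
      hence "norm (\<phi> z - integral {0<..} h) < 1" using Z[of z] by (simp add: dist_norm)
      thus ?thesis using norm_triangle_ineq2[of "\<phi> z" "integral {0<..} h"] by linarith
    qed (use M[of z] that in auto)
    thus ?thesis by blast
  qed
  show "(\<phi> has_vector_derivative h z) (at z)" if z: "z > 0" "isCont h z" for z
  proof -
    have "(\<phi> has_vector_derivative h z) (at z within {0..z+1})"
      unfolding \<phi>_def
      using integral_has_vector_derivative_continuous_at[OF int[of "z+1"], of z "{}"] z
        continuous_at_imp_continuous_at_within[OF z(2), of "{0..z+1} - {}"]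
      by simp
    thus ?thesis using z at_within_Icc_at[of 0 z "z+1"] by simp
  qed
qed

text \<open>
  Integrating by parts over \<open>{0..Z}\<close> leaves the boundary term \<open>exp (- t * Z)\<close> times the integral over
  \<open>{0..Z}\<close>, which vanishes as \<open>Z\<close> grows. The right-hand side makes sense for every \<open>t\<close> with
  \<open>Re t > 0\<close>, whether or not the left-hand integrand is absolutely integrable, and thereby continues
  the transform of a merely conditionally integrable \<open>h\<close>.
\<close>

lemma laplace_by_parts:
  fixes h :: "real \<Rightarrow> complex"
  assumes h: "h integrable_on {0<..}" "continuous_on {0<..} h" and t: "Re t > 0"
    and int: "integrable lborel (\<lambda>z. indicator {0<..} z *\<^sub>R (exp (- t * of_real z) * h z))"
  shows "half_line_laplace h t = t * half_line_laplace (\<lambda>z. integral {0..z} h) t"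
proof -
  define \<phi> where "\<phi> = (\<lambda>z. integral {0..z} h)"
  note \<phi> = indefinite_half_line_integral(1,2,4)[OF h(1), folded \<phi>_def]
  obtain M where M: "\<And>z. z > 0 \<Longrightarrow> norm (\<phi> z) \<le> M"
    using indefinite_half_line_integral(3)[OF h(1)] unfolding \<phi>_def by blast
  have \<phi>': "continuous_on {0<..} \<phi>" by (rule continuous_on_subset[OF \<phi>(1)]) auto
  have int\<phi>: "integrable lborel (\<lambda>z. indicator {0<..} z *\<^sub>R (exp (- t * of_real z) * \<phi> z))"
    by (rule integrable_half_line_laplace[OF \<phi>' M t])
  note lim1 = tendsto_integral_half_line[OF int] and lim2 = tendsto_integral_half_line[OF int\<phi>]
  have eq: "integral {0..Z} (\<lambda>z. exp (- t * of_real z) * h z) - t * integral {0..Z} (\<lambda>z. exp (- t * of_real z) * \<phi> z) =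
      exp (- t * of_real Z) * \<phi> Z" if Z: "Z \<ge> 0" for Z
  proof -
    have "((\<lambda>z. exp (- t * of_real z) * h z - t * (exp (- t * of_real z) * \<phi> z)) has_integral
          (exp (- t * of_real Z) * \<phi> Z - exp (- t * of_real 0) * \<phi> 0)) {0..Z}"
    proof (rule fundamental_theorem_of_calculus_interior[OF Z])
      show "continuous_on {0..Z} (\<lambda>z. exp (- t * of_real z) * \<phi> z)"
        by (intro continuous_intros continuous_on_subset[OF \<phi>(1)]) auto
      fix z assume z: "z \<in> {0<..<Z}"
      have "isCont h z" using z continuous_on_interior[OF h(2)] by (auto simp: interior_open)
      hence 1: "(\<phi> has_vector_derivative h z) (at z)" using \<phi>(3) z by auto
      have 2: "((\<lambda>z. exp (- t * of_real z)) has_vector_derivative (- t * exp (- t * of_real z))) (at z)"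
        by (rule has_vector_derivative_real_field) (auto intro!: derivative_eq_intros)
      show "((\<lambda>z. exp (- t * of_real z) * \<phi> z) has_vector_derivative
              exp (- t * of_real z) * h z - t * (exp (- t * of_real z) * \<phi> z)) (at z)"
        using has_vector_derivative_mult[OF 2 1] by (simp add: algebra_simps)
    qed
    moreover have "((\<lambda>z. exp (- t * of_real z) * h z - t * (exp (- t * of_real z) * \<phi> z)) has_integral
        (integral {0..Z} (\<lambda>z. exp (- t * of_real z) * h z) - t * integral {0..Z} (\<lambda>z. exp (- t * of_real z) * \<phi> z))) {0..Z}"
      using lim1(2)[OF Z] lim2(2)[OF Z] by (intro has_integral_diff has_integral_mult_right) (auto simp: has_integral_iff)
    ultimately have "exp (- t * of_real Z) * \<phi> Z - exp (- t * of_real 0) * \<phi> 0 =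
        integral {0..Z} (\<lambda>z. exp (- t * of_real z) * h z) - t * integral {0..Z} (\<lambda>z. exp (- t * of_real z) * \<phi> z)"
      by (rule has_integral_unique)
    moreover have "\<phi> 0 = 0" by (simp add: \<phi>_def)
    ultimately show ?thesis by simp
  qed
  have "((\<lambda>Z. exp (- t * of_real Z) * \<phi> Z) \<longlongrightarrow> half_line_laplace h t - t * half_line_laplace \<phi> t) at_top"
  proof (rule Lim_transform_eventually)
    show "((\<lambda>Z. integral {0..Z} (\<lambda>z. exp (- t * of_real z) * h z) - t * integral {0..Z} (\<lambda>z. exp (- t * of_real z) * \<phi> z)) \<longlongrightarrow>
        half_line_laplace h t - t * half_line_laplace \<phi> t) at_top"
      unfolding half_line_laplace_def by (intro tendsto_intros lim1 lim2)
    show "eventually (\<lambda>Z. integral {0..Z} (\<lambda>z. exp (- t * of_real z) * h z) - t * integral {0..Z} (\<lambda>z. exp (- t * of_real z) * \<phi> z) =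
        exp (- t * of_real Z) * \<phi> Z) at_top"
      using eventually_ge_at_top[of 0] by eventually_elim (rule eq)
  qed
  moreover have "((\<lambda>Z. exp (- t * of_real Z) * \<phi> Z) \<longlongrightarrow> 0 * integral {0<..} h) at_top"
    by (intro tendsto_mult tendsto_exp_decay t \<phi>(2))
  ultimately have "half_line_laplace h t - t * half_line_laplace \<phi> t = 0 * integral {0<..} h"
    by (rule tendsto_unique[OF trivial_limit_at_top_linorder])
  thus ?thesis by (simp add: \<phi>_def)
qed

section \<open>Laplace transforms of power series\<close>

lemma integral_norm_Gamma_scaled:
  fixes a :: complex and r :: real
  assumes "Re a > 0" "r > 0"
  shows "(LINT x|lborel. norm (indicator {0<..} x *\<^sub>R (of_real x powr (a - 1) * of_real (exp (- (r * x))) :: complex)))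
          = Gamma (Re a) / r powr Re a"
proof -
  let ?f = "\<lambda>x. indicator {0<..} x *\<^sub>R (of_real x powr (a - 1) * of_real (exp (- (r * x))) :: complex)"
  let ?g = "\<lambda>x. indicator {0<..} x *\<^sub>R (of_real x powr (of_real (Re a) - 1) * of_real (exp (- (r * x))) :: complex)"
  have "has_bochner_integral lborel ?g (Gamma (of_real (Re a)) / of_real r powr of_real (Re a))"
    by (rule has_bochner_integral_Gamma_scaled) (use assms in auto)
  moreover have "?g = (\<lambda>x. of_real (norm (?f x)))"
  proof
    fix x
    show "?g x = of_real (norm (?f x))"
      using powr_of_real[of x "Re a - 1"] by (auto simp: indicator_def norm_mult norm_powr_real_powr)
  qed
  moreover have "Gamma (of_real (Re a)) / of_real r powr of_real (Re a) = complex_of_real (Gamma (Re a) / r powr Re a)"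
    using assms powr_of_real[of r "Re a"] by (simp add: Gamma_complex_of_real)
  ultimately have "(LINT x|lborel. complex_of_real (norm (?f x))) = complex_of_real (Gamma (Re a) / r powr Re a)"
    by (simp only: has_bochner_integral_iff)
  thus ?thesis by (simp only: integral_complex_of_real of_real_eq_iff)
qed

text \<open>
  The summands in \<open>abs\<close> are the integrals of the norms of the terms, so the sum and the integral may
  be interchanged.
\<close>

lemma laplace_power_series_absolute:
  fixes d :: "nat \<Rightarrow> complex" and l :: complex and \<nu> r :: real
  assumes "\<nu> > 0" "Re l > 0" "r > 0"
    and d: "\<And>w. summable (\<lambda>j. d j * w ^ j)"
    and abs: "summable (\<lambda>j. norm (d j) * (Gamma (Re l + \<nu> * real j) / r powr (Re l + \<nu> * real j)))"
  defines "g \<equiv> \<lambda>z. of_real z powr (l - 1) * (\<Sum>j. d j * of_real (z powr \<nu>) ^ j)"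
  shows "integrable lborel (\<lambda>z. indicator {0<..} z *\<^sub>R (exp (- of_real r * of_real z) * g z))"
    and "half_line_laplace g (of_real r) =
           of_real r powr (- l) * (\<Sum>j. (d j * Gamma (l + of_real \<nu> * of_nat j)) * of_real (r powr (- \<nu>)) ^ j)"
proof -
  define a where "a = (\<lambda>j. l + of_real \<nu> * of_nat j)"
  define h where "h = (\<lambda>j z. indicator {0<..} z *\<^sub>R (of_real z powr (a j - 1) * of_real (exp (- (r * z))) :: complex))"
  have a: "Re (a j) > 0" for j using assms(1,2) by (simp add: a_def add_pos_nonneg)
  have h: "has_bochner_integral lborel (h j) (Gamma (a j) / of_real r powr a j)" for j
    unfolding h_def by (rule has_bochner_integral_Gamma_scaled[OF a assms(3)])
  have nh: "(LINT z|lborel. norm (h j z)) = Gamma (Re (a j)) / r powr Re (a j)" for j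
    unfolding h_def by (rule integral_norm_Gamma_scaled[OF a assms(3)])
  have hj: "d j * h j z = (indicator {0<..} z *\<^sub>R (of_real z powr (l - 1) * of_real (exp (- (r * z))))) * (d j * of_real (z powr \<nu>) ^ j)" for j z
  proof (cases "z > 0")
    case True
    have "a j - 1 = (l - 1) + of_real \<nu> * of_nat j" by (simp add: a_def)
    hence "of_real z powr (a j - 1) = complex_of_real z powr (l - 1) * of_real (z powr \<nu>) ^ j"
      by (simp only: of_real_powr_add_multiple[OF True])
    thus ?thesis using True by (simp add: h_def)
  qed (auto simp: h_def)
  have int: "integrable lborel (\<lambda>z. d j * h j z)" for j
    using h[of j] by (auto simp: has_bochner_integral_iff)
  have sum1: "AE z in lborel. summable (\<lambda>j. norm (d j * h j z))"
  proof (rule AE_I2)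
    fix z :: real
    have "summable (\<lambda>j. norm (d j * of_real (z powr \<nu>) ^ j))"
      using powser_insidea[OF d, of "of_real (z powr \<nu>)" "of_real (z powr \<nu> + 1)"] by simp
    thus "summable (\<lambda>j. norm (d j * h j z))"
      unfolding hj norm_mult[of "indicator {0<..} z *\<^sub>R _"] by (rule summable_mult)
  qed
  have sum2: "summable (\<lambda>j. LINT z|lborel. norm (d j * h j z))"
    using abs unfolding norm_mult integral_mult_right_zero nh by (simp add: a_def)
  have S: "(\<Sum>j. d j * h j z) = indicator {0<..} z *\<^sub>R (exp (- of_real r * of_real z) * g z)" for z
  proof -
    have "(\<Sum>j. d j * h j z) = (indicator {0<..} z *\<^sub>R (of_real z powr (l - 1) * of_real (exp (- (r * z))))) * (\<Sum>j. d j * of_real (z powr \<nu>) ^ j)"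
      unfolding hj by (rule suminf_mult[OF d])
    moreover have "complex_of_real (exp (- (r * z))) = exp (- of_real r * of_real z)"
      by (simp flip: exp_of_real)
    ultimately show ?thesis by (simp add: g_def)
  qed
  show "integrable lborel (\<lambda>z. indicator {0<..} z *\<^sub>R (exp (- of_real r * of_real z) * g z))"
    using integrable_suminf[OF int sum1 sum2] unfolding S .
  have term_eq: "(LINT z|lborel. d j * h j z) = of_real r powr (- l) * ((d j * Gamma (a j)) * of_real (r powr (- \<nu>)) ^ j)" for j
  proof -
    have "inverse (of_real r powr a j) = of_real r powr (- l) * complex_of_real (r powr (- \<nu>)) ^ j"
      using of_real_powr_add_multiple[OF assms(3), of "- l" "- \<nu>" j] by (simp add: a_def powr_minus[symmetric])
    moreover have "(LINT z|lborel. h j z) = Gamma (a j) * inverse (of_real r powr a j)"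
      using h[of j] by (simp add: has_bochner_integral_iff divide_inverse)
    ultimately show ?thesis by simp
  qed
  have "half_line_laplace g (of_real r) = (\<Sum>j. LINT z|lborel. d j * h j z)"
    using integral_suminf[OF int sum1 sum2] unfolding S half_line_laplace_def .
  also have "\<dots> = (\<Sum>j. of_real r powr (- l) * ((d j * Gamma (a j)) * of_real (r powr (- \<nu>)) ^ j))"
    by (simp only: term_eq)
  also have "\<dots> = of_real r powr (- l) * (\<Sum>j. (d j * Gamma (a j)) * of_real (r powr (- \<nu>)) ^ j)"
  proof (rule suminf_mult)
    have "summable (\<lambda>j. of_real r powr (- l) * ((d j * Gamma (a j)) * of_real (r powr (- \<nu>)) ^ j))"
      using summable_integral[OF int sum1 sum2] by (simp only: term_eq)
    thus "summable (\<lambda>j. (d j * Gamma (a j)) * of_real (r powr (- \<nu>)) ^ j)"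
      using assms(3) by (simp add: summable_cmult_iff)
  qed
  finally show "half_line_laplace g (of_real r) =
           of_real r powr (- l) * (\<Sum>j. (d j * Gamma (l + of_real \<nu> * of_nat j)) * of_real (r powr (- \<nu>)) ^ j)"
    by (simp only: a_def)
qed

text \<open>
  Both the integral and the series may converge only conditionally at \<open>s\<close>. The identity is
  established for large real arguments, continued analytically to the convex region \<open>S\<close>, and
  carried to the boundary point \<open>t = 0\<close> of \<open>S\<close> by the two Abelian theorems.
\<close>

lemma laplace_power_series:
  fixes d :: "nat \<Rightarrow> complex" and l s :: complex and \<nu> :: real
  assumes \<nu>: "\<nu> > 0" and l: "Re l > 0" and s: "Re s > 0"
    and d: "\<And>w. summable (\<lambda>j. d j * w ^ j)"
  defines "A \<equiv> \<lambda>j. d j * Gamma (l + of_real \<nu> * of_nat j)"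
    and "g \<equiv> \<lambda>z. of_real z powr (l - 1) * (\<Sum>j. d j * of_real (z powr \<nu>) ^ j)"
  assumes A: "summable (\<lambda>j. A j * (s powr (- of_real \<nu>)) ^ j)"
    and int: "(\<lambda>z. exp (- s * of_real z) * g z) integrable_on {0<..}"
  shows "integral {0<..} (\<lambda>z. exp (- s * of_real z) * g z) =
           s powr (- l) * (\<Sum>j. A j * (s powr (- of_real \<nu>)) ^ j)"
proof -
  define u0 where "u0 = s powr (- of_real \<nu>)"
  define P where "P = (\<lambda>u. \<Sum>j. A j * u ^ j)"
  define F where "F = (\<lambda>w. w powr (- l) * P (w powr (- of_real \<nu>)))"
  define h where "h = (\<lambda>z. exp (- s * of_real z) * g z)"
  define \<phi> where "\<phi> = (\<lambda>z. integral {0..z} h)"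
  define S where "S = {t. Re t > 0} \<inter> {t. Re (t * cnj s) > 0}"
  have s0: "s \<noteq> 0" using s by auto
  have \<nu>R: "- complex_of_real \<nu> \<in> \<real>" by simp
  have P: "P holomorphic_on ball 0 (norm u0)"
  proof (rule power_series_holomorphic)
    fix u :: complex assume "u \<in> ball 0 (norm u0)"
    hence "summable (\<lambda>j. A j * u ^ j)"
      using powser_inside[OF A, of u] by (simp add: u0_def)
    thus "(\<lambda>j. A j * (u - 0) ^ j) sums P u" by (simp add: P_def summable_sums)
  qed
  have small: "norm (w powr (- of_real \<nu>)) < norm u0" if "norm w > norm s" for w :: complex
    unfolding u0_def norm_powr_real_powr'[OF \<nu>R] using that \<nu> s0 by (auto intro: powr_less_mono2_neg)
  have large: "half_line_laplace g (of_real r) = F (of_real r) \<and>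
      integrable lborel (\<lambda>z. indicator {0<..} z *\<^sub>R (exp (- of_real r * of_real z) * g z))" if r: "r > norm s" for r :: real
  proof -
    have r0: "r > 0" using r norm_ge_zero[of s] by linarith
    have rp: "complex_of_real r powr (- of_real \<nu>) = of_real (r powr (- \<nu>))"
      using powr_of_real[of r "- \<nu>"] r0 by simp
    \<comment> \<open>\<open>C\<close> is the constant from \<open>norm_Gamma_shift_ge\<close>, together with the power \<open>r powr Re l\<close> that is common to all terms.\<close>
    define C where "C = Gamma (Re l) / (norm (Gamma l) * r powr Re l)"
    have "norm (Gamma l) > 0" using Gamma_nonzero_Re_pos[OF l] by simp
    have sm: "summable (\<lambda>j. norm (A j * of_real (r powr (- \<nu>)) ^ j))"
      using powser_insidea[OF A small[of "of_real r", unfolded u0_def]] r r0 unfolding rp by simp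
    have "summable (\<lambda>j. norm (d j) * (Gamma (Re l + \<nu> * real j) / r powr (Re l + \<nu> * real j)))"
    proof (rule summable_comparison_test'[OF summable_mult[OF sm, of C], of 0])
      fix j :: nat
      have pos: "Gamma (Re l + \<nu> * real j) > 0"
        using \<nu> l by (intro Gamma_real_pos add_pos_nonneg) auto
      have rr: "r powr (Re l + \<nu> * real j) = r powr Re l / (r powr (- \<nu>)) ^ j"
      proof -
        have "(r powr (- \<nu>)) ^ j = inverse (r powr (\<nu> * real j))"
          using r0 by (simp add: powr_powr powr_minus[symmetric] flip: powr_realpow)
        thus ?thesis by (simp add: powr_add divide_inverse)
      qed
      have "norm (Gamma l) * Gamma (Re l + \<nu> * real j) \<le> Gamma (Re l) * norm (Gamma (l + of_real \<nu> * of_nat j))"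
        using norm_Gamma_shift_ge[OF l, of "\<nu> * real j"] \<nu> by simp
      hence "Gamma (Re l + \<nu> * real j) / r powr Re l \<le> C * norm (Gamma (l + of_real \<nu> * of_nat j))"
        using \<open>norm (Gamma l) > 0\<close> r0 unfolding C_def by (simp add: field_simps)
      hence "norm (d j) * (Gamma (Re l + \<nu> * real j) / r powr Re l * (r powr (- \<nu>)) ^ j) \<le>
             norm (d j) * (C * norm (Gamma (l + of_real \<nu> * of_nat j)) * (r powr (- \<nu>)) ^ j)"
        by (intro mult_left_mono mult_right_mono) auto
      thus "norm (norm (d j) * (Gamma (Re l + \<nu> * real j) / r powr (Re l + \<nu> * real j))) \<le>
              C * norm (A j * of_real (r powr (- \<nu>)) ^ j)"
        using pos unfolding rr by (simp add: A_def norm_mult norm_power mult_ac)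
    qed
    from laplace_power_series_absolute[OF \<nu> l r0 d this] show ?thesis
      unfolding g_def F_def P_def A_def rp by blast
  qed
  have contg: "continuous_on {0<..} g"
  proof -
    have "isCont (\<lambda>w. \<Sum>j. d j * w ^ j) w" for w
      by (rule DERIV_isCont[OF termdiffs_strong_converges_everywhere[OF d]])
    hence "continuous_on UNIV (\<lambda>w. \<Sum>j. d j * w ^ j)" by (simp add: continuous_at_imp_continuous_on)
    hence "continuous_on {0<..} (\<lambda>z. \<Sum>j. d j * complex_of_real (z powr \<nu>) ^ j)"
      by (rule continuous_on_compose2) (auto intro!: continuous_intros)
    thus ?thesis unfolding g_def by (intro continuous_intros) (auto simp: complex_nonpos_Reals_iff)
  qed
  have conth: "continuous_on {0<..} h" unfolding h_def by (intro continuous_intros contg)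
  note \<phi> = indefinite_half_line_integral(1,2)[OF int[folded h_def], folded \<phi>_def]
  obtain M where M: "\<And>z. z > 0 \<Longrightarrow> norm (\<phi> z) \<le> M"
    using indefinite_half_line_integral(3)[OF int[folded h_def]] unfolding \<phi>_def by blast
  have real_eq: "(of_real r - s) * half_line_laplace \<phi> (of_real r - s) = F (of_real r)" if r: "r > norm s" for r :: real
  proof -
    have eq: "exp (- (of_real r - s) * of_real z) * h z = exp (- of_real r * of_real z) * g z" for z
      by (simp add: h_def mult.assoc[symmetric] exp_add[symmetric] algebra_simps)
    have "Re (of_real r - s) > 0" using r complex_Re_le_cmod[of s] by simp
    from laplace_by_parts[OF int[folded h_def] conth this] large[OF r]
    show ?thesis unfolding eq \<phi>_def[symmetric] half_line_laplace_def by simp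
  qed
  have S: "open S" "convex S"
  proof -
    have "{t. Re (t * cnj s) > 0} = {t. inner s t > 0}"
      by (auto simp: inner_complex_def mult.commute)
    thus "open S" "convex S" unfolding S_def
      by (auto intro: open_Int convex_Int open_halfspace_Re_gt convex_halfspace_Re_gt
          open_halfspace_gt convex_halfspace_gt)
  qed
  \<comment> \<open>The condition \<open>Re (t * cnj s) > 0\<close> keeps \<open>s + t\<close> outside the closed disc of radius \<open>norm s\<close>, where the series may diverge.\<close>
  have Snorm: "norm (s + t) > norm s" "Re (s + t) > 0" if "t \<in> S" for t
  proof -
    show "Re (s + t) > 0" using that s by (simp add: S_def)
    have "norm s * norm s < Re ((s + t) * cnj s)"
      using that by (simp add: S_def distrib_right complex_norm_square[symmetric] power2_eq_square)
    also have "\<dots> \<le> norm ((s + t) * cnj s)" by (rule complex_Re_le_cmod)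
    finally show "norm (s + t) > norm s" using s0 by (simp add: norm_mult)
  qed
  have holF: "(\<lambda>t. F (s + t)) holomorphic_on S"
  proof -
    have "(\<lambda>t. (s + t) powr (- of_real \<nu>)) holomorphic_on S"
      by (intro holomorphic_intros) (use Snorm in \<open>force simp: complex_nonpos_Reals_iff\<close>)
    hence "(P \<circ> (\<lambda>t. (s + t) powr (- of_real \<nu>))) holomorphic_on S"
      by (rule holomorphic_on_compose_gen[OF _ P]) (use small Snorm in auto)
    thus ?thesis unfolding F_def o_def
      by (intro holomorphic_intros) (use Snorm in \<open>force simp: complex_nonpos_Reals_iff\<close>)
  qed
  have holH: "(\<lambda>t. t * half_line_laplace \<phi> t - F (s + t)) holomorphic_on S"
    by (intro holomorphic_intros holF holomorphic_on_subset[OF holomorphic_half_line_laplace[OF \<phi>(1) M]])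
       (auto simp: S_def)
  \<comment> \<open>For real \<open>r\<close> the inequality \<open>Re ((r - s) * cnj s) > 0\<close> reads \<open>r > R\<close>.\<close>
  define R where "R = (norm s)\<^sup>2 / Re s"
  have R: "R \<ge> norm s"
  proof -
    have "norm s * Re s \<le> norm s * norm s" by (intro mult_left_mono complex_Re_le_cmod) auto
    thus ?thesis using s by (simp add: R_def field_simps power2_eq_square)
  qed
  have RS: "of_real r - s \<in> S" if "r > R" for r :: real
  proof -
    have "Re s < r" using that R complex_Re_le_cmod[of s] by linarith
    moreover have "r * Re s > (norm s)\<^sup>2" using that s by (simp add: R_def field_simps)
    moreover have "Re ((of_real r - s) * cnj s) = r * Re s - (norm s)\<^sup>2"
      unfolding cmod_power2 by (simp add: power2_eq_square algebra_simps)
    ultimately show ?thesis by (simp only: S_def Int_iff mem_Collect_eq) simp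
  qed
  have eqS: "t * half_line_laplace \<phi> t - F (s + t) = 0" if t: "t \<in> S" for t
  proof (rule analytic_continuation[OF holH S(1) convex_connected[OF S(2)] _ RS _ _ t])
    let ?U = "(\<lambda>r. of_real r - s) ` {R<..}"
    show "?U \<subseteq> S" using RS by auto
    show "R + 1 > R" by simp
    show "complex_of_real (R + 1) - s islimpt ?U"
      unfolding islimpt_sequential
    proof (intro exI conjI allI)
      let ?x = "\<lambda>n::nat. complex_of_real (R + 1 + inverse (real (Suc n))) - s"
      show "?x n \<in> ?U - {complex_of_real (R + 1) - s}" for n
      proof -
        have pos: "inverse (real (Suc n)) > 0" by simp
        hence "R + 1 + inverse (real (Suc n)) \<in> {R<..}" unfolding greaterThan_iff by linarith
        hence "?x n \<in> ?U" by (rule imageI)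
        moreover have "?x n \<noteq> complex_of_real (R + 1) - s"
          using pos by (simp del: of_nat_Suc)
        ultimately show ?thesis by blast
      qed
      have "?x \<longlonglongrightarrow> complex_of_real (R + 1 + 0) - s"
        by (intro tendsto_intros LIMSEQ_inverse_real_of_nat)
      thus "?x \<longlonglongrightarrow> complex_of_real (R + 1) - s" by simp
    qed
    show "z * half_line_laplace \<phi> z - F (s + z) = 0" if "z \<in> ?U" for z
      using that real_eq R by auto
  qed
  define \<tau> where "\<tau> = (\<lambda>n::nat. s / of_nat (Suc n))"
  have "(\<lambda>n. \<tau> n * half_line_laplace \<phi> (\<tau> n)) \<longlonglongrightarrow> integral {0<..} h"
    unfolding \<tau>_def by (rule half_line_laplace_abelian[OF \<phi>(1) M \<phi>(2) s])
  moreover have "\<tau> n * half_line_laplace \<phi> (\<tau> n) = F (s + \<tau> n)" for n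
  proof -
    have "\<tau> n * cnj s = of_real ((norm s)\<^sup>2 / real (Suc n))"
      by (simp add: \<tau>_def complex_norm_square[symmetric] del: of_nat_Suc)
    hence "Re (\<tau> n * cnj s) = (norm s)\<^sup>2 / real (Suc n)" by (simp only: Re_complex_of_real)
    also have "\<dots> > 0" using s0 by simp
    finally have "Re (\<tau> n * cnj s) > 0" .
    moreover have "\<tau> n = s / of_real (real (Suc n))" by (simp add: \<tau>_def)
    hence "Re (\<tau> n) > 0" using s by (simp del: of_nat_Suc)
    ultimately have "\<tau> n \<in> S" by (simp only: S_def Int_iff mem_Collect_eq)
    from eqS[OF this] show ?thesis by simp
  qed
  ultimately have lim1: "(\<lambda>n. F (s + \<tau> n)) \<longlonglongrightarrow> integral {0<..} h" by simp
  have lim2: "(\<lambda>n. F (s + \<tau> n)) \<longlonglongrightarrow> s powr (- l) * P u0"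
  proof -
    \<comment> \<open>Here \<open>s + \<tau> n = c n * s\<close> with \<open>c n\<close> real, so the argument of the power series is \<open>u0\<close> times a real factor in \<open>(0, 1)\<close>.\<close>
    define c where "c = (\<lambda>n::nat. 1 + inverse (real (Suc n)))"
    have c1: "c n > 1" for n by (simp add: c_def)
    have st: "s + \<tau> n = of_real (c n) * s" for n
      by (simp add: \<tau>_def c_def distrib_left divide_inverse mult.commute)
    have c: "c \<longlonglongrightarrow> 1" unfolding c_def using tendsto_add[OF tendsto_const[of 1] LIMSEQ_inverse_real_of_nat] by simp
    have "(\<lambda>n. c n powr (- \<nu>)) \<longlonglongrightarrow> 1 powr (- \<nu>)" by (intro tendsto_intros c) auto
    moreover have "c n powr (- \<nu>) < 1" for n
      using powr_less_mono2_neg[of "- \<nu>" 1 "c n"] c1[of n] \<nu> by simp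
    moreover from this have "c n powr (- \<nu>) \<noteq> 1" for n
      by (metis less_irrefl)
    ultimately have "filterlim (\<lambda>n. c n powr (- \<nu>)) (at_left 1) sequentially"
      by (auto simp: filterlim_at intro!: always_eventually)
    from filterlim_compose[OF Abel_theorem[OF A[folded u0_def]] this]
    have "(\<lambda>n. \<Sum>j. A j * u0 ^ j * of_real (c n powr (- \<nu>)) ^ j) \<longlonglongrightarrow> P u0"
      by (simp only: P_def)
    moreover have "(\<Sum>j. A j * u0 ^ j * of_real (c n powr (- \<nu>)) ^ j) = P ((s + \<tau> n) powr (- of_real \<nu>))" for n
    proof -
      have "(s + \<tau> n) powr (- of_real \<nu>) = of_real (c n powr (- \<nu>)) * u0"
        using c1[of n] powr_of_real[of "c n" "- \<nu>"]
        by (simp add: st u0_def powr_times_real_left)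
      thus ?thesis by (simp add: P_def power_mult_distrib mult_ac)
    qed
    ultimately have 1: "(\<lambda>n. P ((s + \<tau> n) powr (- of_real \<nu>))) \<longlonglongrightarrow> P u0" by simp
    have "(\<lambda>n. of_real (c n) * s) \<longlonglongrightarrow> of_real 1 * s" by (intro tendsto_intros c)
    hence "(\<lambda>n. s + \<tau> n) \<longlonglongrightarrow> s" by (simp add: st)
    hence "(\<lambda>n. (s + \<tau> n) powr (- l)) \<longlonglongrightarrow> s powr (- l)"
      by (intro tendsto_intros) (use s in \<open>auto simp: complex_nonpos_Reals_iff\<close>)
    from tendsto_mult[OF this 1] show ?thesis by (simp add: F_def)
  qed
  show ?thesis using LIMSEQ_unique[OF lim1 lim2] by (simp only: h_def P_def u0_def)
qed

section \<open>The k-Mittag-Leffler function\<close>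

text \<open>
  Inversion commutes with principal powers away from the negative real axis.
\<close>

lemma of_real_divide_powr:
  assumes "Re s > 0" "x > 0"
  shows "(of_real x / s) powr of_real \<nu> = of_real (x powr \<nu>) * s powr (- of_real \<nu>)"
proof -
  have "s \<notin> \<real>\<^sub>\<le>\<^sub>0" "s \<noteq> 0" using assms by (auto simp: complex_nonpos_Reals_iff)
  hence "inverse s powr of_real \<nu> = s powr (- of_real \<nu>)"
    by (simp add: powr_def Ln_inverse)
  moreover have "(of_real x * inverse s) powr of_real \<nu> = of_real x powr of_real \<nu> * inverse s powr of_real \<nu>"
    using assms by (intro powr_times_real_left) auto
  ultimately show ?thesis using assms powr_of_real[of x \<nu>] by (simp add: divide_inverse)
qed

text \<open>
  Collecting the powers of \<open>k\<close> and using that \<open>\<xi> / k\<close> is real puts the coefficients in Fox-Wright form.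
\<close>

lemma k_Mittag_Leffler_term_eq:
  assumes "k > 0" and a: "\<xi> / of_real k = of_real a"
  shows "k_Mittag_Leffler_term k \<xi> \<zeta> \<theta> q w n =
     of_real k powr (1 - \<zeta> / of_real k) / Gamma (\<theta> / of_real k) *
     (Gamma (\<theta> / of_real k + of_real q * of_nat n) / Gamma (\<zeta> / of_real k + of_real a * of_nat n) *
       of_real (k powr (q - a)) ^ n / fact n) * w ^ n"
proof -
  have arg: "(of_nat n * \<xi> + \<zeta>) / of_real k = \<zeta> / of_real k + of_real a * of_nat n"
    by (simp add: a[symmetric] add_divide_distrib)
  have "complex_of_real k powr of_real (of_nat n * q) / of_real k powr (\<zeta> / of_real k + of_real a * of_nat n - 1)
     = of_real k powr (of_real (of_nat n * q) - (\<zeta> / of_real k + of_real a * of_nat n - 1))"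
    by (simp only: powr_diff)
  also have "of_real (of_nat n * q) - (\<zeta> / of_real k + of_real a * of_nat n - 1) =
      (1 - \<zeta> / of_real k) + of_real (q - a) * of_nat n"
    by (simp add: algebra_simps)
  also have "of_real k powr \<dots> = of_real k powr (1 - \<zeta> / of_real k) * of_real (k powr (q - a)) ^ n"
    by (rule of_real_powr_add_multiple[OF assms(1)])
  finally have pw: "complex_of_real k powr of_real (of_nat n * q) / of_real k powr (\<zeta> / of_real k + of_real a * of_nat n - 1)
     = of_real k powr (1 - \<zeta> / of_real k) * of_real (k powr (q - a)) ^ n" .
  have "k_Mittag_Leffler_term k \<xi> \<zeta> \<theta> q w n =
      (complex_of_real k powr of_real (of_nat n * q) / of_real k powr (\<zeta> / of_real k + of_real a * of_nat n - 1)) *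
      (Gamma (\<theta> / of_real k + of_real q * of_nat n) / Gamma (\<theta> / of_real k)) /
      (Gamma (\<zeta> / of_real k + of_real a * of_nat n) * fact n) * w ^ n"
    unfolding k_Mittag_Leffler_term_def k_Gamma_def k_pochhammer_def gen_pochhammer_def arg
    by (simp add: mult_ac)
  thus ?thesis unfolding pw by (simp add: mult_ac)
qed

lemma frac_deriv_cong:
  assumes "\<And>t. t > 0 \<Longrightarrow> f t = g t"
  shows "frac_deriv \<eta> \<sigma> f x = frac_deriv \<eta> \<sigma> g x"
proof -
  have "frac_integral \<eta> \<sigma> f = frac_integral \<eta> \<sigma> g"
    unfolding frac_integral_def frac_kernel_def by (intro ext integral_cong) (use assms in auto)
  thus ?thesis by (simp add: frac_deriv_def)
qed

theorem theorem5:
  fixes x \<eta> \<nu> k q :: real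
    and \<sigma> \<mu> \<xi> \<zeta> \<theta> l m s :: complex
    and f :: "real \<Rightarrow> real \<Rightarrow> complex"
    and g :: "real \<Rightarrow> complex"
    and as bs :: "(complex \<times> real) list"
    and w :: complex
  defines "f \<equiv> \<lambda>z t. of_real t powr \<mu> * k_Mittag_Leffler k \<xi> \<zeta> \<theta> q (of_real ((t * z) powr \<nu>))"
    and "g \<equiv> \<lambda>z. of_real z powr (l - 1) * frac_deriv \<eta> \<sigma> (f z) x"
    and "as \<equiv> [(\<theta> / of_real k, q), (\<mu> / of_real \<eta> + 1, \<nu> / \<eta>), (l, \<nu>)]"
    and "bs \<equiv> [(\<zeta> / of_real k, Re (\<xi> / of_real k)), (\<mu> / of_real \<eta> - \<sigma> + 1, \<nu> / \<eta>)]"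
    and "w \<equiv> of_real k powr (of_real q - \<xi> / of_real k) * (of_real x / s) powr of_real \<nu>"
  assumes "x > 0" and "q > 0" and "\<eta> > 0"
    and "Re \<sigma> > 0" and "Re \<xi> > 0" and "Re \<zeta> > 0" and "Re \<theta> > 0" and "Re \<mu> > 0"
    and "Re l > 0" and "Re m > 0" and "Re s > 0"
    and "\<xi> / of_real k \<in> \<real>" and "Re (\<xi> / of_real k) > 0"
    and "\<nu> / \<eta> > 0" and "\<nu> > 0"
    and "1 + Re (\<xi> / of_real k) - q - \<nu> \<ge> 0"
    and "\<And>z. z > 0 \<Longrightarrow>
           frac_deriv_exists \<eta> \<sigma>
             {t. t > 0 \<and> summable (k_Mittag_Leffler_term k \<xi> \<zeta> \<theta> q (of_real ((t * z) powr \<nu>)))}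
             (f z) x"
    and "laplace_exists g s"
    and "summable (fox_wright_term as bs w)"
  shows "laplace g s =
           of_real x powr (\<mu> - \<sigma> * of_real \<eta>) / s powr l *
           (of_real \<eta> powr \<sigma> / Gamma (\<theta> / of_real k)) *
           of_real k powr (1 - \<zeta> / of_real k) * fox_wright as bs w"
proof -
  note [simp] = \<open>x > 0\<close> \<open>\<eta> > 0\<close> \<open>\<nu> > 0\<close>
  have [simp]: "x \<noteq> 0" "\<eta> \<noteq> 0" "\<nu> \<noteq> 0"
    using \<open>x > 0\<close> \<open>\<eta> > 0\<close> \<open>\<nu> > 0\<close> by (metis less_irrefl)+
  define a where "a = Re (\<xi> / of_real k)"
  have a: "\<xi> / of_real k = of_real a"
    using \<open>\<xi> / of_real k \<in> \<real>\<close> by (simp only: a_def of_real_Re)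
  have k: "k > 0"
  proof -
    have "Re \<xi> / k > 0" using \<open>Re (\<xi> / of_real k) > 0\<close> by simp
    thus ?thesis using \<open>Re \<xi> > 0\<close> by (simp add: zero_less_divide_iff)
  qed
  \<comment> \<open>\<open>C\<close> is the factor common to all Mittag-Leffler coefficients \<open>c n\<close>; below, \<open>G\<close> collects the Gamma quotients and \<open>K\<close> the constant that the fractional derivative contributes.\<close>
  define C where "C = of_real k powr (1 - \<zeta> / of_real k) / Gamma (\<theta> / of_real k)"
  have C: "C \<noteq> 0"
    using Gamma_nonzero_Re_pos[of "\<theta> / of_real k"] k \<open>Re \<theta> > 0\<close> by (simp add: C_def)
  define c where "c = (\<lambda>n. C * (Gamma (\<theta> / of_real k + of_real q * of_nat n) / Gamma (\<zeta> / of_real k + of_real a * of_nat n) *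
       of_real (k powr (q - a)) ^ n / fact n))"
  have ml_term: "k_Mittag_Leffler_term k \<xi> \<zeta> \<theta> q u n = c n * u ^ n" for u n
    unfolding c_def C_def by (rule k_Mittag_Leffler_term_eq[OF k a])
  have c: "summable (\<lambda>n. c n * u ^ n)" for u
  proof -
    \<comment> \<open>With this \<open>z\<close>, the convergence hypothesis at \<open>t = x\<close> is convergence at the argument \<open>norm u + 1\<close>.\<close>
    define z where "z = (norm u + 1) powr (1 / \<nu>) / x"
    have "norm u + 1 > 0" by (simp add: add_nonneg_pos)
    hence z: "z > 0" "(x * z) powr \<nu> = norm u + 1"
      using \<open>x > 0\<close> \<open>\<nu> > 0\<close> by (auto simp: z_def powr_powr)
    from assms(22)[OF z(1)] obtain b where "b > x"
      "{0<..<b} \<subseteq> {t. t > 0 \<and> summable (k_Mittag_Leffler_term k \<xi> \<zeta> \<theta> q (of_real ((t * z) powr \<nu>)))}"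
      unfolding frac_deriv_exists_def by blast
    moreover from this(1) have "x \<in> {0<..<b}" by simp
    ultimately have "summable (k_Mittag_Leffler_term k \<xi> \<zeta> \<theta> q (of_real ((x * z) powr \<nu>)))" by blast
    also have "k_Mittag_Leffler_term k \<xi> \<zeta> \<theta> q (of_real ((x * z) powr \<nu>)) = (\<lambda>n. c n * of_real (norm u + 1) ^ n)"
      by (intro ext) (simp only: ml_term z(2))
    finally have "summable (\<lambda>n. c n * of_real (norm u + 1) ^ n)" .
    thus ?thesis by (rule powser_inside) (simp add: norm_of_real del: of_real_add)
  qed
  define G where "G = (\<lambda>j::nat. Gamma ((\<mu> + of_real \<nu> * of_nat j) / of_real \<eta> + 1) / Gamma ((\<mu> + of_real \<nu> * of_nat j) / of_real \<eta> - \<sigma> + 1))"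
  define d where "d = (\<lambda>j. c j * G j * of_real (x powr \<nu>) ^ j)"
  define K where "K = of_real \<eta> powr \<sigma> * of_real x powr (\<mu> - \<sigma> * of_real \<eta>)"
  have K: "K \<noteq> 0" by (simp add: K_def)
  have d: "summable (\<lambda>j. d j * u ^ j)" for u
    using frac_deriv_power_series(1)[OF \<open>\<eta> > 0\<close> \<open>\<nu> > 0\<close> \<open>Re \<mu> > 0\<close> \<open>Re \<sigma> > 0\<close> \<open>x > 0\<close> c, of "of_real (x powr \<nu>) * u"]
    by (simp add: d_def G_def power_mult_distrib mult_ac)
  define g' where "g' = (\<lambda>z. of_real z powr (l - 1) * (\<Sum>j. d j * of_real (z powr \<nu>) ^ j))"
  have g: "g z = K * g' z" if z: "z > 0" for z
  proof -
    have cz: "summable (\<lambda>j. c j * of_real (z powr \<nu>) ^ j * u ^ j)" for u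
      using c[of "of_real (z powr \<nu>) * u"] by (simp add: power_mult_distrib mult_ac)
    have "frac_deriv \<eta> \<sigma> (f z) x =
        frac_deriv \<eta> \<sigma> (\<lambda>t. of_real t powr \<mu> * (\<Sum>j. (c j * of_real (z powr \<nu>) ^ j) * of_real (t powr \<nu>) ^ j)) x"
      using z by (intro frac_deriv_cong) (simp add: f_def k_Mittag_Leffler_def ml_term powr_mult power_mult_distrib mult_ac)
    also have "\<dots> = K * (\<Sum>j. c j * of_real (z powr \<nu>) ^ j * G j * of_real (x powr \<nu>) ^ j)"
      using frac_deriv_power_series(2)[OF \<open>\<eta> > 0\<close> \<open>\<nu> > 0\<close> \<open>Re \<mu> > 0\<close> \<open>Re \<sigma> > 0\<close> \<open>x > 0\<close> cz]
      by (simp only: K_def G_def)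
    also have "(\<lambda>j. c j * of_real (z powr \<nu>) ^ j * G j * of_real (x powr \<nu>) ^ j) = (\<lambda>j. d j * of_real (z powr \<nu>) ^ j)"
      by (simp add: d_def mult_ac)
    finally show ?thesis by (simp add: g_def g'_def mult_ac)
  qed
  have fw: "(d j * Gamma (l + of_real \<nu> * of_nat j)) * (s powr (- of_real \<nu>)) ^ j = C * fox_wright_term as bs w j" for j
  proof -
    have w: "w = of_real (k powr (q - a)) * (of_real (x powr \<nu>) * s powr (- of_real \<nu>))"
      using of_real_divide_powr[OF \<open>Re s > 0\<close> \<open>x > 0\<close>, of \<nu>] powr_of_real[of k "q - a"] k
      by (simp add: w_def a)
    have eqs: "\<mu> / of_real \<eta> + 1 + of_real (\<nu> / \<eta>) * of_nat j = (\<mu> + of_real \<nu> * of_nat j) / of_real \<eta> + 1"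
      "\<mu> / of_real \<eta> - \<sigma> + 1 + of_real (\<nu> / \<eta>) * of_nat j = (\<mu> + of_real \<nu> * of_nat j) / of_real \<eta> - \<sigma> + 1"
      by (simp_all add: add_divide_distrib)
    show ?thesis
      unfolding fox_wright_term_def as_def bs_def a_def[symmetric]
      unfolding list.map prod_list.Cons prod_list.Nil prod.case eqs
      by (simp add: w d_def c_def G_def power_mult_distrib mult_ac)
  qed
  have sm: "summable (\<lambda>j. (d j * Gamma (l + of_real \<nu> * of_nat j)) * (s powr (- of_real \<nu>)) ^ j)"
    unfolding fw by (rule summable_mult) fact
  have eqg: "exp (- s * of_real z) * g z = K * (exp (- s * of_real z) * g' z)" if "z \<in> {0<..}" for z
    using g[of z] that by simp
  have "(\<lambda>z. exp (- s * of_real z) * g z) integrable_on {0<..}"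
    using \<open>laplace_exists g s\<close> by (simp add: laplace_exists_def)
  hence "(\<lambda>z. inverse K * (exp (- s * of_real z) * g z)) integrable_on {0<..}"
    by (rule integrable_on_mult_right)
  hence int: "(\<lambda>z. exp (- s * of_real z) * g' z) integrable_on {0<..}"
    by (rule integrable_eq) (use eqg K in \<open>simp add: field_simps\<close>)
  have "laplace g s = integral {0<..} (\<lambda>z. K * (exp (- s * of_real z) * g' z))"
    unfolding laplace_def by (rule integral_cong) (rule eqg)
  also have "\<dots> = K * integral {0<..} (\<lambda>z. exp (- s * of_real z) * g' z)"
    by (rule integral_mult_right)
  also have "integral {0<..} (\<lambda>z. exp (- s * of_real z) * g' z) =
      s powr (- l) * (\<Sum>j. (d j * Gamma (l + of_real \<nu> * of_nat j)) * (s powr (- of_real \<nu>)) ^ j)"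
    unfolding g'_def
    by (rule laplace_power_series[OF \<open>\<nu> > 0\<close> \<open>Re l > 0\<close> \<open>Re s > 0\<close> d sm int[unfolded g'_def]])
  also have "(\<Sum>j. (d j * Gamma (l + of_real \<nu> * of_nat j)) * (s powr (- of_real \<nu>)) ^ j) = C * fox_wright as bs w"
    unfolding fw fox_wright_def by (rule suminf_mult) fact
  finally show ?thesis
    by (simp add: K_def C_def powr_minus divide_inverse mult_ac)
qed

end
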